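(* Let $Z=m_{11}P_{11}+m_{12}P_{12}+m_{21}P_{21}$ be a set of fat points in $\mathbb{P}^1\times\mathbb{P}^1$ with $m_{11},m_{12},m_{21}\ge 0$ integers and $m_{12}\ge m_{21}$. Let $D(Z)=D_1(Z)\cup D_2(Z)\cup D_3(Z)\cup D_4(Z)\subseteq\mathbb{N}^2$, with the sets $D_i(Z)$ defined in the context. If $m_{11}>m_{21}$, then for all $(a,b)\in\mathbb{N}^2$ $$\Delta H_Z(a,b)=\begin{cases}1 & \text{if } (a,b)<(i,j) \text{ for some } (i,j)\in D(Z),\\ 1-\beta_{0,(a,b)}(Z) & \text{if } (a,b)\in D(Z),\\ 0 & \text{otherwise,}\end{cases}$$ where $(a,b)<(i,j)$ means $a\le i$, $b\le j$ and $(a,b)\neq(i,j)$.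
   Context: $k$ is an infinite field of characteristic $0$, and $R=k[x_0,x_1,x_2,x_3]$ is the coordinate ring of $\mathbb{P}^1\times\mathbb{P}^1$, bigraded by $\deg x_0=\deg x_1=(1,0)$, $\deg x_2=\deg x_3=(0,1)$. $\mathbb{N}=\{0,1,2,\dots\}$ and $(n)_+:=\max\{n,0\}$. Fat points: let $H_1,H_2$ be two non-proportional nonzero forms of degree $(1,0)$ and $V_1,V_2$ two non-proportional nonzero forms of degree $(0,1)$. $P_{ij}$ is the point with bihomogeneous ideal $I_{P_{ij}}=(H_i,V_j)$. For $Z=m_{11}P_{11}+m_{12}P_{12}+m_{21}P_{21}$ put $I_Z=I_{P_{11}}^{m_{11}}\cap I_{P_{12}}^{m_{12}}\cap I_{P_{21}}^{m_{21}}$ (with $I^0=R$). $\beta_{0,(a,b)}(Z)$ denotes the number of elements of bidegree $(a,b)$ in a minimal set of bihomogeneous generators of $I_Z$. Hilbert function: $H_Z(a,b)=\dim_k(R/I_Z)_{(a,b)}$ (equal to $0$ if $a<0$ or $b<0$), and its first difference is $\Delta H_Z(a,b)=H_Z(a,b)+H_Z(a-1,b-1)-H_Z(a-1,b)-H_Z(a,b-1)$. The sets $D_i(Z)$, with $B=m_{12}-m_{11}$: $D_1(Z)=\{(a,b)\in\mathbb{N}^2 : 0\le b<(-B)_+-(-B-m_{21})_+,\ a+2b=m_{11}+m_{21}\}$; $D_2(Z)=\{(a,b)\in\mathbb{N}^2 : (-B)_+-(-B-m_{21})_+\le b<m_{21},\ a+b=\max\{m_{11},m_{12}+m_{21}\}\}$;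 $D_3(Z)=\{(a,b)\in\mathbb{N}^2 : m_{21}\le b\le m_{21}+|B+m_{21}|,\ a+b=\max\{m_{11},m_{12}+m_{21}\}\}$; $D_4(Z)=\{(a,b)\in\mathbb{N}^2 : b>m_{21}+|B+m_{21}|,\ 2a+b=m_{11}+m_{12}\}$. *)

theory Defs
  imports
    "HOL-Algebra.Algebraic_Closure_Type"
    "HOL-Algebra.Embedded_Algebras"
    "HOL-Algebra.Ideal_Product"
    "HOL-Algebra.QuotRing"
    "HOL-Library.Poly_Mapping"
    "HOL-Library.Numeral_Type"
begin

text \<open>
  The polynomial ring \<open>k[x\<^sub>0, x\<^sub>1, x\<^sub>2, x\<^sub>3]\<close>: finitely supported coefficient functions on exponent
  vectors, where the index type \<open>4\<close> has the elements \<open>0, 1, 2, 3\<close>. The multiplication of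
  \<^typ>\<open>'a \<Rightarrow>\<^sub>0 'b\<close> is convolution.
\<close>

type_synonym 'k bipoly = "(4 \<Rightarrow>\<^sub>0 nat) \<Rightarrow>\<^sub>0 'k"

abbreviation bring :: "('k::field) bipoly ring" where
  "bring \<equiv> ring_of_type_algebra"

definition bconst :: "'k::field \<Rightarrow> 'k bipoly" where
  "bconst c = Poly_Mapping.single 0 c"

text \<open>
  The graded piece \<open>R\<^bsub>(a,b)\<^esub>\<close> for \<open>deg x\<^sub>0 = deg x\<^sub>1 = (1,0)\<close> and \<open>deg x\<^sub>2 = deg x\<^sub>3 = (0,1)\<close>;
  it contains the zero polynomial.
\<close>

definition bihom :: "nat \<Rightarrow> nat \<Rightarrow> ('k::field) bipoly set" where
  "bihom a b = {p. \<forall>e \<in> Poly_Mapping.keys p.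
     Poly_Mapping.lookup e 0 + Poly_Mapping.lookup e 1 = a \<and>
     Poly_Mapping.lookup e 2 + Poly_Mapping.lookup e 3 = b}"

definition nonproportional :: "('k::field) bipoly \<Rightarrow> 'k bipoly \<Rightarrow> bool" where
  "nonproportional p q \<longleftrightarrow> \<not> (\<exists>c. p = bconst c * q) \<and> \<not> (\<exists>c. q = bconst c * p)"

definition point_ideal :: "('k::field) bipoly \<Rightarrow> 'k bipoly \<Rightarrow> 'k bipoly set" where
  "point_ideal H V = Idl\<^bsub>bring\<^esub> {H, V}"

text \<open>
  Powers of ideals are taken in the monoid of ideals under the ideal product, whose unit is the
  whole ring.
\<close>

definition ideal_power :: "('k::field) bipoly set \<Rightarrow> nat \<Rightarrow> 'k bipoly set" where
  "ideal_power I m = I [^]\<^bsub>ideals_set bring\<^esub> m"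

definition fat_ideal ::
  "('k::field) bipoly \<Rightarrow> 'k bipoly \<Rightarrow> 'k bipoly \<Rightarrow> 'k bipoly \<Rightarrow> nat \<Rightarrow> nat \<Rightarrow> nat \<Rightarrow> 'k bipoly set"
where
  "fat_ideal H1 H2 V1 V2 m11 m12 m21 =
     ideal_power (point_ideal H1 V1) m11 \<inter>
     ideal_power (point_ideal H1 V2) m12 \<inter>
     ideal_power (point_ideal H2 V1) m21"

text \<open>
  \<open>(R/I)\<^bsub>(a,b)\<^esub>\<close> is the image of \<open>R\<^bsub>(a,b)\<^esub>\<close> in \<open>R/I\<close>; its dimension is taken over the image of \<open>k\<close>.
\<close>

definition hilbert :: "('k::field) bipoly set \<Rightarrow> int \<Rightarrow> int \<Rightarrow> int" where
  "hilbert I a b =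
     (if a < 0 \<or> b < 0 then 0
      else int (ring.dim (bring Quot I)
                 (range (\<lambda>c. I +>\<^bsub>bring\<^esub> bconst c))
                 ((\<lambda>p. I +>\<^bsub>bring\<^esub> p) ` bihom (nat a) (nat b))))"

definition delta_hilbert :: "('k::field) bipoly set \<Rightarrow> int \<Rightarrow> int \<Rightarrow> int" where
  "delta_hilbert I a b =
     hilbert I a b + hilbert I (a - 1) (b - 1) - hilbert I (a - 1) b - hilbert I a (b - 1)"

text \<open>Minimality is with respect to inclusion; it excludes \<open>0\<close> from a generating set.\<close>

definition minimal_bihom_generators :: "('k::field) bipoly set \<Rightarrow> 'k bipoly set \<Rightarrow> bool" where
  "minimal_bihom_generators I G \<longleftrightarrow>
     (\<forall>g \<in> G. \<exists>a b. g \<in> bihom a b) \<and>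
     Idl\<^bsub>bring\<^esub> G = I \<and>
     (\<forall>G'. G' \<subset> G \<longrightarrow> Idl\<^bsub>bring\<^esub> G' \<noteq> I)"

text \<open>
  For a bihomogeneous ideal the number described here does not depend on the choice of \<open>G\<close>
  (graded Nakayama lemma), so the definite description is well defined.
\<close>

definition betti0 :: "('k::field) bipoly set \<Rightarrow> nat \<Rightarrow> nat \<Rightarrow> nat" where
  "betti0 I a b =
     (THE n. \<exists>G. minimal_bihom_generators I G \<and> finite (G \<inter> bihom a b) \<and> card (G \<inter> bihom a b) = n)"

definition ppart :: "int \<Rightarrow> int" where
  "ppart n = max n 0"

definition D1 :: "nat \<Rightarrow> nat \<Rightarrow> nat \<Rightarrow> (nat \<times> nat) set" where
  "D1 m11 m12 m21 = (let B = int m12 - int m11 in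
     {(a, b). int b < ppart (- B) - ppart (- B - int m21) \<and> a + 2 * b = m11 + m21})"

definition D2 :: "nat \<Rightarrow> nat \<Rightarrow> nat \<Rightarrow> (nat \<times> nat) set" where
  "D2 m11 m12 m21 = (let B = int m12 - int m11 in
     {(a, b). ppart (- B) - ppart (- B - int m21) \<le> int b \<and> b < m21 \<and>
              a + b = max m11 (m12 + m21)})"

definition D3 :: "nat \<Rightarrow> nat \<Rightarrow> nat \<Rightarrow> (nat \<times> nat) set" where
  "D3 m11 m12 m21 = (let B = int m12 - int m11 in
     {(a, b). m21 \<le> b \<and> int b \<le> int m21 + \<bar>B + int m21\<bar> \<and> a + b = max m11 (m12 + m21)})"

definition D4 :: "nat \<Rightarrow> nat \<Rightarrow> nat \<Rightarrow> (nat \<times> nat) set" where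
  "D4 m11 m12 m21 = (let B = int m12 - int m11 in
     {(a, b). int b > int m21 + \<bar>B + int m21\<bar> \<and> 2 * a + b = m11 + m12})"

definition DZ :: "nat \<Rightarrow> nat \<Rightarrow> nat \<Rightarrow> (nat \<times> nat) set" where
  "DZ m11 m12 m21 =
     D1 m11 m12 m21 \<union> D2 m11 m12 m21 \<union> D3 m11 m12 m21 \<union> D4 m11 m12 m21"

definition bideg_less :: "nat \<times> nat \<Rightarrow> nat \<times> nat \<Rightarrow> bool" where
  "bideg_less d d' \<longleftrightarrow> fst d \<le> fst d' \<and> snd d \<le> snd d' \<and> d \<noteq> d'"

end

(* After a linear change of coordinates the four forms become the variables, so that I_Z is the
   monomial ideal of the exponents (p,q,r,s) with p + r >= m11, p + s >= m12 and q + r >= m21. The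
   Hilbert function then counts monomials outside the ideal, and by the graded Nakayama lemma the
   Betti number counts minimal exponents. Lowering q affects only the third condition and lowering s
   only the second one; by inclusion-exclusion 1 - Delta H_Z(a,b) is the number of exponents of
   bidegree (a,b) in which neither q nor s can be lowered. Such an exponent is determined by (p,r),
   with q = (m21 - r)_+ and s = (m12 - p)_+, and what remains is arithmetic: no such (p,r) below D(Z),
   only minimal exponents on D(Z), and exactly one (p,r) beyond D(Z). *)

theory Submission
  imports Defs
begin

section \<open>Ideals of the polynomial ring\<close>

text \<open>Write m, n, l for m11, m12, m21 and x1, x3 for the variables that stand for H_2 and V_2;
  each of these two forms occurs in only one of the three point ideals. The exponents that survive
  inclusion-exclusion form a monomial basis of I / (x1 I + x3 I), while the Betti number is the
  dimension of the further quotient of I by its product with all four variables. So the claim on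
  D(Z) is that the two quotients agree there, and elsewhere only the size of the first one matters.
  The number \<open>betti0\<close> is a definite description over all minimal bihomogeneous
  generating sets. Counting the monomial generators therefore does not determine it: every other
  minimal generating set, whose elements need not be monomials, must be shown to have the same
  number of elements in each bidegree.\<close>

lemma bring_simps [simp]:
  "carrier bring = UNIV" "x \<otimes>\<^bsub>bring\<^esub> y = x * y" "x \<oplus>\<^bsub>bring\<^esub> y = x + y"
  "\<zero>\<^bsub>bring\<^esub> = 0" "\<one>\<^bsub>bring\<^esub> = 1"
  by (simp_all add: ring_of_type_algebra_def)

lemma ring_bring: "ring bring"
  by (rule ring_from_type_algebra)

text \<open>Additive inverses come from multiplication by -1, and absorption on the other side from
  commutativity.\<close>

lemma ideal_bringI:
  assumes "0 \<in> I" "\<And>x y. x \<in> I \<Longrightarrow> y \<in> I \<Longrightarrow> x + y \<in> I" "\<And>r x. x \<in> I \<Longrightarrow> r * x \<in> I"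
  shows "ideal I bring"
proof (rule idealI)
  have "subgroup I (add_monoid bring)"
  proof (rule group.subgroupI)
    show "group (add_monoid bring)"
      using ring_bring abelian_group.a_group ring.is_abelian_group by blast
    fix x assume x: "x \<in> I"
    have "inv\<^bsub>add_monoid bring\<^esub> x = - x"
      by (rule group.inv_equality[OF abelian_group.a_group[OF ring.is_abelian_group[OF ring_bring]]]) auto
    with assms(3)[OF x, of "-1"] show "inv\<^bsub>add_monoid bring\<^esub> x \<in> I" by simp
  qed (use assms(1,2) in auto)
  then show "subgroup I (add_monoid bring)" .
qed (use assms ring_bring in \<open>auto simp: mult.commute\<close>)

lemma ideal_bringD:
  assumes "ideal I bring"
  shows "0 \<in> I" "\<And>x y. x \<in> I \<Longrightarrow> y \<in> I \<Longrightarrow> x + y \<in> I" "\<And>r x. x \<in> I \<Longrightarrow> r * x \<in> I"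
    "\<And>x y. x \<in> I \<Longrightarrow> y \<in> I \<Longrightarrow> x - y \<in> I"
    "\<And>f A. (\<And>i. i \<in> A \<Longrightarrow> f i \<in> I) \<Longrightarrow> sum f A \<in> I"
proof -
  note ax = ideal.axioms(1)[OF assms]
  show 0: "0 \<in> I" using additive_subgroup.zero_closed[OF ax] by simp
  show add: "x + y \<in> I" if "x \<in> I" "y \<in> I" for x y using additive_subgroup.a_closed[OF ax that] by simp
  show m: "r * x \<in> I" if "x \<in> I" for r x using ideal.I_l_closed[OF assms that, of r] by simp
  show "x - y \<in> I" if "x \<in> I" "y \<in> I" for x y using add[OF that(1) m[OF that(2), of "-1"]] by simp
  show "sum f A \<in> I" if "\<And>i. i \<in> A \<Longrightarrow> f i \<in> I" for f :: "'z \<Rightarrow> _" and A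
    using that by (induction A rule: infinite_finite_induct) (auto intro: 0 add)
qed

lemma genideal_bring_ideal: "ideal (Idl\<^bsub>bring\<^esub> G) bring"
  by (rule ring.genideal_ideal[OF ring_bring]) simp

lemma genideal_bring_self: "G \<subseteq> Idl\<^bsub>bring\<^esub> G"
  by (rule ring.genideal_self[OF ring_bring]) simp

lemma genideal_bring_minimal: "ideal I bring \<Longrightarrow> G \<subseteq> I \<Longrightarrow> Idl\<^bsub>bring\<^esub> G \<subseteq> I"
  by (rule ring.genideal_minimal[OF ring_bring])

lemma genideal_bring_mono: "G \<subseteq> H \<Longrightarrow> Idl\<^bsub>bring\<^esub> G \<subseteq> Idl\<^bsub>bring\<^esub> H"
  by (rule genideal_bring_minimal[OF genideal_bring_ideal]) (use genideal_bring_self in blast)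

text \<open>\<open>P\<close> itself need not be stable under multiplication, so the argument uses
  the ideal of those \<open>f\<close> for which \<open>P (r * f)\<close> holds for every
  \<open>r\<close>; taking \<open>r = 1\<close> recovers \<open>P f\<close>.\<close>

lemma genideal_bring_induct [consumes 1, case_names zero add mult]:
  assumes "f \<in> Idl\<^bsub>bring\<^esub> G"
    and "P 0"
    and "\<And>f g. f \<in> Idl\<^bsub>bring\<^esub> G \<Longrightarrow> g \<in> Idl\<^bsub>bring\<^esub> G \<Longrightarrow> P f \<Longrightarrow> P g \<Longrightarrow> P (f + g)"
    and "\<And>r g. g \<in> G \<Longrightarrow> P (r * g)"
  shows "P f"
proof -
  note I = ideal_bringD[OF genideal_bring_ideal[of G]]
  have "ideal {f \<in> Idl\<^bsub>bring\<^esub> G. \<forall>r. P (r * f)} bring"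
    by (rule ideal_bringI) (use assms(2,3) I in \<open>auto simp: distrib_left simp flip: mult.assoc\<close>)
  moreover have "G \<subseteq> {f \<in> Idl\<^bsub>bring\<^esub> G. \<forall>r. P (r * f)}"
    using assms(4) genideal_bring_self by auto
  ultimately have "f \<in> {f \<in> Idl\<^bsub>bring\<^esub> G. \<forall>r. P (r * f)}"
    using genideal_bring_minimal assms(1) by blast
  then show ?thesis by (metis (mono_tags, lifting) mem_Collect_eq mult_1)
qed

section \<open>Polynomials as sums of terms and as vectors over k\<close>

lemma poly_mapping_eq_sum_single:
  assumes "finite A" "Poly_Mapping.keys f \<subseteq> A"
  shows "f = (\<Sum>e\<in>A. Poly_Mapping.single e (Poly_Mapping.lookup f e))"
  by (rule poly_mapping_eqI)
    (use assms in \<open>auto simp: lookup_sum lookup_single when_def in_keys_iff sum.delta\<close>)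

lemma poly_mapping_induct_single [case_names zero single add]:
  assumes "P 0" "\<And>e c. P (Poly_Mapping.single e c)" "\<And>f g. P f \<Longrightarrow> P g \<Longrightarrow> P (f + g)"
  shows "P (f :: 'a \<Rightarrow>\<^sub>0 'b::comm_monoid_add)"
proof -
  have "P (\<Sum>e\<in>A. Poly_Mapping.single e (Poly_Mapping.lookup f e))" for A
    by (induction A rule: infinite_finite_induct) (use assms in auto)
  from this[of "Poly_Mapping.keys f"] show ?thesis
    by (simp flip: poly_mapping_eq_sum_single[of "Poly_Mapping.keys f" f])
qed

lemma lookup_single_mult:
  fixes c :: "'k::comm_semiring_1" and e :: "'a \<Rightarrow>\<^sub>0 nat"
  shows "Poly_Mapping.lookup (Poly_Mapping.single e c * f) (e + d) = c * Poly_Mapping.lookup f d"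
  by (induction f rule: poly_mapping_induct_single)
    (auto simp: mult_single lookup_single when_def distrib_left lookup_add)

lemma bconst_mult_lookup: "Poly_Mapping.lookup (bconst c * f) d = c * Poly_Mapping.lookup f d"
  using lookup_single_mult[of 0 c f d] by (simp add: bconst_def)

lemma bconst_simps:
  "bconst 0 = 0" "bconst 1 = 1" "bconst (c + d) = bconst c + bconst d" "bconst (c * d) = bconst c * bconst d"
  "bconst (c - d) = bconst c - bconst d" "bconst (- c) = - bconst c"
  by (simp_all add: bconst_def single_add mult_single single_uminus single_diff)

text \<open>Scaling in the shape that the \<open>vector_space\<close> locale expects, which gives
  access to spans, independence and dimension.\<close>

definition bscale :: "'k::field \<Rightarrow> 'k bipoly \<Rightarrow> 'k bipoly" where
  "bscale c f = bconst c * f"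

interpretation bvs: vector_space bscale
  by standard (simp_all add: bscale_def bconst_simps algebra_simps)

lemma single_eq_bscale: "Poly_Mapping.single e c = bscale c (Poly_Mapping.single e 1)"
  by (simp add: bscale_def bconst_def mult_single)

section \<open>Monomial ideals\<close>

definition monom_ideal :: "(4 \<Rightarrow>\<^sub>0 nat) set \<Rightarrow> 'k::field bipoly set" where
  "monom_ideal S = {f. Poly_Mapping.keys f \<subseteq> S}"

definition up_closed :: "(4 \<Rightarrow>\<^sub>0 nat) set \<Rightarrow> bool" where
  "up_closed S \<longleftrightarrow> (\<forall>e\<in>S. \<forall>d. d + e \<in> S)"

lemma monom_ideal_ideal: "up_closed S \<Longrightarrow> ideal (monom_ideal S) bring"
proof (rule ideal_bringI, goal_cases)
  case (2 x y)
  then show ?case using Poly_Mapping.keys_add[of x y] by (auto simp: monom_ideal_def)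
next
  case (3 r x)
  then show ?case using keys_mult[of r x] unfolding monom_ideal_def up_closed_def by blast
qed (simp add: monom_ideal_def)

lemma single_mem_monom_ideal: "e \<in> S \<Longrightarrow> Poly_Mapping.single e c \<in> monom_ideal S"
  by (auto simp: monom_ideal_def)

lemma monom_ideal_eq_genideal:
  fixes A :: "(4 \<Rightarrow>\<^sub>0 nat) set"
  shows "Idl\<^bsub>bring\<^esub> ((\<lambda>e. Poly_Mapping.single e 1) ` A) = monom_ideal {d + e | d e. e \<in> A}" (is "Idl\<^bsub>bring\<^esub> ?G = ?J")
proof
  have "up_closed {d + e | d e. e \<in> A}"
    unfolding up_closed_def by clarify (metis add.assoc[where 'a="4 \<Rightarrow>\<^sub>0 nat"]) 
  moreover have "?G \<subseteq> ?J"
  proof clarify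
    fix e assume "e \<in> A"
    then have "0 + e \<in> {d + e | d e. e \<in> A}" by blast
    then show "Poly_Mapping.single e 1 \<in> ?J" by (simp add: single_mem_monom_ideal)
  qed
  ultimately show "Idl\<^bsub>bring\<^esub> ?G \<subseteq> ?J"
    by (intro genideal_bring_minimal monom_ideal_ideal)
  show "?J \<subseteq> Idl\<^bsub>bring\<^esub> ?G"
  proof
    fix f assume f: "f \<in> ?J"
    note I = ideal_bringD[OF genideal_bring_ideal[of ?G]]
    have "Poly_Mapping.single e c \<in> Idl\<^bsub>bring\<^esub> ?G" if "e \<in> Poly_Mapping.keys f" for e c
    proof -
      from that f obtain d a where a: "a \<in> A" "e = d + a" by (auto simp: monom_ideal_def)
      have "Poly_Mapping.single d c * Poly_Mapping.single a 1 \<in> Idl\<^bsub>bring\<^esub> ?G"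
        using a genideal_bring_self[of ?G] by (intro I) auto
      then show ?thesis by (simp add: mult_single a)
    qed
    then have "(\<Sum>e\<in>Poly_Mapping.keys f. Poly_Mapping.single e (Poly_Mapping.lookup f e)) \<in> Idl\<^bsub>bring\<^esub> ?G"
      by (intro I)
    then show "f \<in> Idl\<^bsub>bring\<^esub> ?G" using poly_mapping_eq_sum_single[of "Poly_Mapping.keys f" f] by simp
  qed
qed

section \<open>Hilbert functions by counting a basis\<close>

text \<open>The dimension in \<open>hilbert\<close> is taken over a subfield of the quotient ring,
  so k has to be handled as a set of ring elements.\<close>

lemma subfield_range_bconst: "subfield (range (bconst :: 'k::field \<Rightarrow> _)) bring"
proof -
  let ?k = "ring_of_type_algebra :: 'k ring"
  have k: "field ?k" by (rule field_from_type_algebra)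
  interpret k: field ?k by (rule k)
  have "ring_hom_ring ?k bring bconst"
    by (rule ring_hom_ringI2[OF k.ring_axioms ring_bring])
      (auto simp: ring_hom_def ring_of_type_algebra_def bconst_simps)
  from ring_hom_ring.img_is_subfield(2)[OF this k.carrier_is_subfield]
  show ?thesis by (simp add: ring_of_type_algebra_def)
qed

lemma coset_bring_eq_iff:
  assumes "ideal I bring"
  shows "I +>\<^bsub>bring\<^esub> p = I +>\<^bsub>bring\<^esub> q \<longleftrightarrow> p - q \<in> I"
proof
  note I = ideal_bringD[OF assms]
  have c: "I +>\<^bsub>bring\<^esub> r = {i + r | i. i \<in> I}" for r
    unfolding a_r_coset_def' by auto
  show "p - q \<in> I" if "I +>\<^bsub>bring\<^esub> p = I +>\<^bsub>bring\<^esub> q"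
  proof -
    have "0 + p \<in> I +>\<^bsub>bring\<^esub> q"
      unfolding that[symmetric] unfolding c using I(1) by blast
    then have "0 + p \<in> {i + q | i. i \<in> I}" unfolding c .
    then obtain i where "i \<in> I" "0 + p = i + q" by blast
    then show ?thesis by simp
  qed
  assume d: "p - q \<in> I"
  have *: "i + (p - q) \<in> I" "i - (p - q) \<in> I" if "i \<in> I" for i
    using I(2,4) that d by blast+
  show "I +>\<^bsub>bring\<^esub> p = I +>\<^bsub>bring\<^esub> q"
    unfolding c
  proof (intro Set.set_eqI iffI)
    fix x assume "x \<in> {i + p | i. i \<in> I}"
    then obtain i where "i \<in> I" "x = i + p" by blast
    with *(1)[of i] show "x \<in> {i + q | i. i \<in> I}"
      by (intro CollectI exI[of _ "i + (p - q)"]) simp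
  next
    fix x assume "x \<in> {i + q | i. i \<in> I}"
    then obtain i where "i \<in> I" "x = i + q" by blast
    with *(2)[of i] show "x \<in> {i + p | i. i \<in> I}"
      by (intro CollectI exI[of _ "i - (p - q)"]) simp
  qed
qed

text \<open>The dimension predicate is inductive, one line extension at a time, so the span of every
  subset \<open>F\<close> of \<open>E\<close> is treated; independence modulo \<open>I\<close> makes
  each new vector raise the dimension by one. The family \<open>u\<close> is left general because it
  will consist of images of monomials under a change of coordinates.\<close>

lemma hilbert_eq_card:
  fixes u :: "'e \<Rightarrow> 'k::field bipoly"
  assumes I: "ideal I bring" "1 \<notin> I" and fin: "finite E"
    and u: "\<And>c. (\<Sum>e\<in>E. bscale (c e) (u e)) \<in> bihom a b"
    and span: "\<And>p. p \<in> bihom a b \<Longrightarrow> \<exists>c. p - (\<Sum>e\<in>E. bscale (c e) (u e)) \<in> I"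
    and indep: "\<And>c e. (\<Sum>e\<in>E. bscale (c e) (u e)) \<in> I \<Longrightarrow> e \<in> E \<Longrightarrow> c e = 0"
  shows "hilbert I (int a) (int b) = int (card E)"
proof -
  let ?Q = "bring Quot I"
  define \<pi> where "\<pi> p = I +>\<^bsub>bring\<^esub> p" for p
  define K where "K = range (\<lambda>c. \<pi> (bconst c))"
  interpret Q: ring ?Q by (rule ideal.quotient_is_ring[OF I(1)])
  have hom: "ring_hom_ring bring ?Q ((+>\<^bsub>bring\<^esub>) I)" by (rule ideal.rcos_ring_hom_ring[OF I(1)])
  interpret h: ring_hom_ring bring ?Q \<pi> using hom by (simp add: \<pi>_def[abs_def])
  have eq: "\<pi> p = \<pi> q \<longleftrightarrow> p - q \<in> I" for p q
    unfolding \<pi>_def by (rule coset_bring_eq_iff[OF I(1)])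
  have add: "\<pi> (p + q) = \<pi> p \<oplus>\<^bsub>?Q\<^esub> \<pi> q" and mult: "\<pi> (p * q) = \<pi> p \<otimes>\<^bsub>?Q\<^esub> \<pi> q"
    and one: "\<pi> 1 = \<one>\<^bsub>?Q\<^esub>" and zero: "\<pi> 0 = \<zero>\<^bsub>?Q\<^esub>" and car: "\<pi> p \<in> carrier ?Q" for p q
    using h.hom_add[of p q] h.hom_mult[of p q] h.hom_one h.hom_zero h.hom_closed[of p] by simp_all
  \<comment> \<open>Since \<open>I\<close> is proper, the image of k in the quotient is again a
    field.\<close>
  have "\<one>\<^bsub>?Q\<^esub> \<noteq> \<zero>\<^bsub>?Q\<^esub>"
    using eq[of 1 0] I(2) by (simp add: one zero)
  from h.img_is_subfield(2)[OF subfield_range_bconst this]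
  have K: "subfield K ?Q" by (simp add: K_def image_image)
  define L where "L F = {\<Sum>e\<in>F. bscale (c e) (u e) | c. True}" for F
  have dim: "ring.dimension ?Q (card F) K (\<pi> ` L F)" if "F \<subseteq> E" for F
  proof -
    have "finite F" using that fin by (rule finite_subset)
    then show ?thesis using that
    proof (induction F rule: finite_induct)
      case empty
      have "\<pi> ` L {} = {\<zero>\<^bsub>?Q\<^esub>}" by (simp add: L_def zero)
      then show ?case using Q.zero_dim by simp
    next
      case (insert x F)
      have ext: "\<pi> ` L (insert x F) = ring.line_extension ?Q K (\<pi> (u x)) (\<pi> ` L F)"
      proof (intro Set.set_eqI iffI)
        fix y assume "y \<in> \<pi> ` L (insert x F)"
        then obtain c where "y = \<pi> (\<Sum>e\<in>insert x F. bscale (c e) (u e))" by (auto simp: L_def)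
        then have "y = \<pi> (bconst (c x)) \<otimes>\<^bsub>?Q\<^esub> \<pi> (u x) \<oplus>\<^bsub>?Q\<^esub> \<pi> (\<Sum>e\<in>F. bscale (c e) (u e))"
          using insert.hyps by (simp add: bscale_def add mult)
        then show "y \<in> ring.line_extension ?Q K (\<pi> (u x)) (\<pi> ` L F)"
          unfolding Q.line_extension_mem_iff K_def L_def by blast
      next
        fix y assume "y \<in> ring.line_extension ?Q K (\<pi> (u x)) (\<pi> ` L F)"
        then obtain d c where "y = \<pi> (bconst d) \<otimes>\<^bsub>?Q\<^esub> \<pi> (u x) \<oplus>\<^bsub>?Q\<^esub> \<pi> (\<Sum>e\<in>F. bscale (c e) (u e))"
          unfolding Q.line_extension_mem_iff K_def L_def by blast
        moreover have "(\<Sum>e\<in>F. bscale (c e) (u e)) = (\<Sum>e\<in>F. bscale ((c(x := d)) e) (u e))"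
          using insert.hyps by (intro sum.cong) auto
        ultimately have "y = \<pi> (\<Sum>e\<in>insert x F. bscale ((c(x := d)) e) (u e))"
          using insert.hyps by (simp add: bscale_def add mult)
        then show "y \<in> \<pi> ` L (insert x F)" unfolding L_def by blast
      qed
      have "\<pi> (u x) \<notin> \<pi> ` L F"
      proof
        assume "\<pi> (u x) \<in> \<pi> ` L F"
        then obtain c where c: "u x - (\<Sum>e\<in>F. bscale (c e) (u e)) \<in> I"
          by (auto simp: L_def eq)
        \<comment> \<open>A relation that puts \<open>u x\<close> into the span of \<open>F\<close>
          is rewritten as a relation over all of \<open>E\<close> with coefficient 1 at
          \<open>x\<close>, which \<open>indep\<close> forbids.\<close>
        define d where "d e = (if e = x then 1 else if e \<in> F then - c e else 0)" for e
        have "(\<Sum>e\<in>E. bscale (d e) (u e)) = (\<Sum>e\<in>insert x F. bscale (d e) (u e))"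
          using fin insert.prems by (intro sum.mono_neutral_right) (auto simp: d_def)
        also have "\<dots> = u x + (\<Sum>e\<in>F. bscale (d e) (u e))"
          using insert.hyps by (simp add: d_def)
        also have "(\<Sum>e\<in>F. bscale (d e) (u e)) = (\<Sum>e\<in>F. - bscale (c e) (u e))"
          using insert.hyps by (intro sum.cong) (auto simp: d_def)
        finally have "(\<Sum>e\<in>E. bscale (d e) (u e)) \<in> I"
          using c by (simp add: sum_negf)
        from indep[OF this, of x] insert.prems show False by (simp add: d_def)
      qed
      from Q.Suc_dim[OF car this] insert show ?case by (simp add: ext)
    qed
  qed
  have "\<pi> ` bihom a b = \<pi> ` L E"
  proof
    show "\<pi> ` bihom a b \<subseteq> \<pi> ` L E"
    proof clarify
      fix p :: "'k bipoly" assume "p \<in> bihom a b"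
      from span[OF this] obtain c where "\<pi> p = \<pi> (\<Sum>e\<in>E. bscale (c e) (u e))"
        unfolding eq by blast
      then show "\<pi> p \<in> \<pi> ` L E" unfolding L_def by blast
    qed
    show "\<pi> ` L E \<subseteq> \<pi> ` bihom a b"
      using u by (auto simp: L_def)
  qed
  with dim[of E] have "ring.dim ?Q K (\<pi> ` bihom a b) = card E"
    using Q.dimI[OF K, of "card E"] by (simp add: over_def)
  then show ?thesis
    by (simp add: hilbert_def K_def \<pi>_def[abs_def])
qed

section \<open>Exponents and bidegrees\<close>

lemma exhaust_4: fixes i :: 4 shows "i = 0 \<or> i = 1 \<or> i = 2 \<or> i = 3"
proof (induct i)
  case (of_int z)
  then have "0 \<le> z" "z < 4" by simp_all
  then have "z = 0 \<or> z = 1 \<or> z = 2 \<or> z = 3" by arith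
  then show ?case by auto
qed

lemma exps_eqI:
  fixes d e :: "4 \<Rightarrow>\<^sub>0 nat"
  assumes "Poly_Mapping.lookup d 0 = Poly_Mapping.lookup e 0" "Poly_Mapping.lookup d 1 = Poly_Mapping.lookup e 1"
    "Poly_Mapping.lookup d 2 = Poly_Mapping.lookup e 2" "Poly_Mapping.lookup d 3 = Poly_Mapping.lookup e 3"
  shows "d = e"
proof (rule poly_mapping_eqI)
  fix i :: 4
  show "Poly_Mapping.lookup d i = Poly_Mapping.lookup e i"
    using exhaust_4[of i] assms by auto
qed

definition exps :: "nat \<Rightarrow> nat \<Rightarrow> nat \<Rightarrow> nat \<Rightarrow> (4 \<Rightarrow>\<^sub>0 nat)" where
  "exps p q r s = Poly_Mapping.single 0 p + Poly_Mapping.single 1 q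
     + Poly_Mapping.single 2 r + Poly_Mapping.single 3 s"

lemma lookup_exps [simp]:
  "Poly_Mapping.lookup (exps p q r s) 0 = p" "Poly_Mapping.lookup (exps p q r s) 1 = q"
  "Poly_Mapping.lookup (exps p q r s) 2 = r" "Poly_Mapping.lookup (exps p q r s) 3 = s"
  by (simp_all add: exps_def lookup_add lookup_single)

lemma exps_lookup [simp]:
  "exps (Poly_Mapping.lookup e 0) (Poly_Mapping.lookup e 1)
     (Poly_Mapping.lookup e 2) (Poly_Mapping.lookup e 3) = e"
  by (rule exps_eqI) simp_all

definition bideg :: "(4 \<Rightarrow>\<^sub>0 nat) \<Rightarrow> nat \<times> nat" where
  "bideg e = (Poly_Mapping.lookup e 0 + Poly_Mapping.lookup e 1,
     Poly_Mapping.lookup e 2 + Poly_Mapping.lookup e 3)"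

lemma bihom_eq: "bihom a b = {f. \<forall>e\<in>Poly_Mapping.keys f. bideg e = (a, b)}"
  by (simp add: bihom_def bideg_def)

lemma fst_bideg_add [simp]: "fst (bideg (d + e)) = fst (bideg d) + fst (bideg e)"
  and snd_bideg_add [simp]: "snd (bideg (d + e)) = snd (bideg d) + snd (bideg e)"
  by (simp_all add: bideg_def lookup_add)

lemma bideg_eq_0_iff: "bideg e = (0, 0) \<longleftrightarrow> e = 0"
  by (auto simp: bideg_def intro: exps_eqI)

lemma finite_bideg: "finite {e. bideg e = (a, b)}"
proof (rule finite_subset)
  show "{e. bideg e = (a, b)} \<subseteq> (\<lambda>(p, q, r, s). exps p q r s) ` ({..a} \<times> {..a} \<times> {..b} \<times> {..b})"
  proof
    fix e assume "e \<in> {e. bideg e = (a, b)}"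
    then show "e \<in> (\<lambda>(p, q, r, s). exps p q r s) ` ({..a} \<times> {..a} \<times> {..b} \<times> {..b})"
      by (intro image_eqI[of _ _ "(Poly_Mapping.lookup e 0, Poly_Mapping.lookup e 1,
        Poly_Mapping.lookup e 2, Poly_Mapping.lookup e 3)"]) (auto simp: bideg_def)
  qed
qed simp

lemma bihom_zero: "0 \<in> bihom a b"
  and bihom_add: "f \<in> bihom a b \<Longrightarrow> g \<in> bihom a b \<Longrightarrow> f + g \<in> bihom a b"
  and bihom_single: "bideg e = (a, b) \<Longrightarrow> Poly_Mapping.single e x \<in> bihom a b"
  and bihom_bconst: "bconst x \<in> bihom 0 0"
  using Poly_Mapping.keys_add[of f g] by (auto simp: bihom_eq bconst_def bideg_def)

lemma bihom_mult: "f \<in> bihom a b \<Longrightarrow> g \<in> bihom c d \<Longrightarrow> f * g \<in> bihom (a + c) (b + d)"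
  using keys_mult[of f g] by (fastforce simp: bihom_eq prod_eq_iff)

lemma bihom_bscale: "f \<in> bihom a b \<Longrightarrow> bscale x f \<in> bihom a b"
  using bihom_mult[OF bihom_bconst] by (fastforce simp: bscale_def)

lemma bihom_sum: "(\<And>i. i \<in> A \<Longrightarrow> f i \<in> bihom a b) \<Longrightarrow> sum f A \<in> bihom a b"
  by (induction A rule: infinite_finite_induct) (auto intro: bihom_zero bihom_add)

lemma bihom_disjoint:
  assumes "f \<in> bihom a b" "f \<in> bihom c d" "(a, b) \<noteq> (c, d)"
  shows "f = 0"
  using assms by (metis (mono_tags, lifting) bihom_eq keys_eq_empty equals0I mem_Collect_eq)

section \<open>Restriction of polynomials to sets of exponents\<close>

definition restr :: "(4 \<Rightarrow>\<^sub>0 nat) set \<Rightarrow> 'k::field bipoly \<Rightarrow> 'k bipoly" where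
  "restr M f = (\<Sum>e\<in>M. Poly_Mapping.single e (Poly_Mapping.lookup f e))"

lemma lookup_restr: "finite M \<Longrightarrow> Poly_Mapping.lookup (restr M f) e = (if e \<in> M then Poly_Mapping.lookup f e else 0)"
  by (simp add: restr_def lookup_sum lookup_single when_def)

lemma restr_linear:
  assumes "finite M"
  shows "restr M (f + g) = restr M f + restr M g" "restr M (f - g) = restr M f - restr M g"
    "restr M (bscale c f) = bscale c (restr M f)" "restr M 0 = 0"
  using assms
  by (auto intro!: poly_mapping_eqI simp: lookup_restr lookup_add lookup_minus bscale_def bconst_mult_lookup)

lemma restr_id: "finite M \<Longrightarrow> Poly_Mapping.keys f \<subseteq> M \<Longrightarrow> restr M f = f"
  by (rule poly_mapping_eqI) (auto simp: lookup_restr in_keys_iff)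

lemma restr_0: "finite M \<Longrightarrow> Poly_Mapping.keys f \<inter> M = {} \<Longrightarrow> restr M f = 0"
  by (rule poly_mapping_eqI) (auto simp: lookup_restr in_keys_iff)

text \<open>Multiples of a generator of bidegree (a, b) have terms only in bidegrees at or above (a,
  b), so these generators contribute nothing to the component of bidegree (c, d). This lets
  generators be discarded in the Nakayama argument.\<close>

lemma genideal_restr_bideg:
  fixes G :: "'k::field bipoly set"
  assumes hom: "\<And>g. g \<in> G \<Longrightarrow> \<exists>a b. g \<in> bihom a b"
    and f: "f \<in> Idl\<^bsub>bring\<^esub> G" and ab: "\<not> (a \<le> c \<and> b \<le> d)"
  shows "restr {e. bideg e = (c, d)} f \<in> Idl\<^bsub>bring\<^esub> (G - bihom a b)"
  using f
proof (induction rule: genideal_bring_induct)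
  note I = ideal_bringD[OF genideal_bring_ideal[of "G - bihom a b"]]
  note lin = restr_linear[OF finite_bideg]
  {
    case zero
    then show ?case by (simp add: lin I)
  next
    case (add f g)
    then show ?case by (simp add: lin I)
  next
    case (mult r g)
    obtain a' b' where g: "g \<in> bihom a' b'" using hom mult by blast
    show ?case
    proof (induction r rule: poly_mapping_induct_single)
      case zero
      then show ?case by (simp add: lin I)
    next
      case (add f g)
      then show ?case by (simp add: lin I distrib_right)
    next
      case (single e x)
      let ?h = "Poly_Mapping.single e x * g"
      have h: "?h \<in> bihom (fst (bideg e) + a') (snd (bideg e) + b')"
        by (rule bihom_mult[OF bihom_single g]) simp
      show ?case
      proof (cases "(fst (bideg e) + a', snd (bideg e) + b') = (c, d)")
        case True
        with ab have "(a', b') \<noteq> (a, b)" by auto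
        have "?h \<in> Idl\<^bsub>bring\<^esub> (G - bihom a b)"
        \<comment> \<open>The zero polynomial lies in every \<open>bihom\<close>, so having bidegree
          (a', b') excludes membership in \<open>bihom a b\<close> only for nonzero
          \<open>g\<close>.\<close>
        proof (cases "g = 0")
          case False
          with bihom_disjoint[OF g] \<open>(a', b') \<noteq> (a, b)\<close> have "g \<notin> bihom a b" by blast
          with mult genideal_bring_self show ?thesis by (blast intro: I)
        qed (simp add: I)
        moreover have "restr {e. bideg e = (c, d)} ?h = ?h"
          using h True by (intro restr_id[OF finite_bideg]) (auto simp: bihom_eq)
        ultimately show ?thesis by simp
      next
        case False
        then have "restr {e. bideg e = (c, d)} ?h = 0"
          using h by (intro restr_0[OF finite_bideg]) (auto simp: bihom_eq)
        then show ?thesis by (simp add: I)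
      qed
    qed
  }
qed

section \<open>Minimal generators of monomial ideals\<close>

definition min_exps :: "(4 \<Rightarrow>\<^sub>0 nat) set \<Rightarrow> (4 \<Rightarrow>\<^sub>0 nat) set" where
  "min_exps S = {e \<in> S. \<forall>d. \<forall>e'\<in>S. e = d + e' \<longrightarrow> d = 0}"

lemma min_expsD: "e \<in> min_exps S \<Longrightarrow> e \<in> S" "d + e' \<in> min_exps S \<Longrightarrow> e' \<in> S \<Longrightarrow> d = 0"
  unfolding min_exps_def by blast+

text \<open>Descent on the total degree: a non-minimal exponent splits off a nonzero
  \<open>d\<close> and leaves a smaller element of \<open>S\<close>.\<close>

lemma min_exps_generate:
  assumes "up_closed S"
  shows "{d + e | d e. e \<in> min_exps S} = S"
proof
  show "{d + e | d e. e \<in> min_exps S} \<subseteq> S"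
    using assms by (auto simp: up_closed_def min_exps_def)
  show "S \<subseteq> {d + e | d e. e \<in> min_exps S}"
  proof
    fix e assume "e \<in> S"
    then show "e \<in> {d + e | d e. e \<in> min_exps S}"
    proof (induction "fst (bideg e) + snd (bideg e)" arbitrary: e rule: less_induct)
      case less
      show ?case
      proof (cases "e \<in> min_exps S")
        case True
        have "e = 0 + e" by simp
        with True show ?thesis by blast
      next
        case False
        with less.prems obtain d e' where e: "e' \<in> S" "e = d + e'" "d \<noteq> 0"
          unfolding min_exps_def by blast
        have "bideg d \<noteq> (0, 0)" using e(3) bideg_eq_0_iff by blast
        then have "fst (bideg e') + snd (bideg e') < fst (bideg e) + snd (bideg e)"
          by (auto simp: e(2) prod_eq_iff)
        from less.hyps[OF this e(1)] obtain d' m where "e' = d' + m" "m \<in> min_exps S" by blast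
        then have "e = (d + d') + m" "m \<in> min_exps S" by (simp_all add: e(2) add.assoc)
        then show ?thesis by blast
      qed
    qed
  qed
qed

text \<open>Nonconstant terms of \<open>r\<close> move the exponents of \<open>f\<close> to proper
  multiples of elements of \<open>S\<close>, which are never minimal. Hence \<open>restr M\<close>
  only sees the ideal modulo its product with the irrelevant ideal.\<close>

lemma restr_min_exps_mult:
  assumes "f \<in> monom_ideal S" "finite M" "M \<subseteq> min_exps S"
  shows "restr M (r * f) = bscale (Poly_Mapping.lookup r 0) (restr M f)"
proof (induction r rule: poly_mapping_induct_single)
  case zero
  then show ?case using assms(2) by (simp add: restr_linear)
next
  case (add r s)
  then show ?case
    using assms(2) by (simp add: restr_linear distrib_right lookup_add bvs.scale_left_distrib)
next
  case (single e c)
  show ?case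
  proof (cases "e = 0")
    case True
    then show ?thesis
      using restr_linear(3)[OF assms(2), of c f] by (simp add: bscale_def bconst_def)
  next
    case False
    have "m \<notin> Poly_Mapping.keys (Poly_Mapping.single e c * f)" if "m \<in> M" for m
    proof
      assume "m \<in> Poly_Mapping.keys (Poly_Mapping.single e c * f)"
      with keys_mult obtain d e' where "m = d + e'" "d \<in> Poly_Mapping.keys (Poly_Mapping.single e c)"
        "e' \<in> Poly_Mapping.keys f" by blast
      then have "m = e + e'" "e' \<in> S"
        using assms(1) by (auto simp: monom_ideal_def split: if_splits)
      with min_expsD(2) that assms(3) False show False by blast
    qed
    with False show ?thesis by (subst restr_0[OF assms(2)]) (auto simp: lookup_single)
  qed
qed

lemma minimal_bihom_generators_monom_ideal:
  assumes "up_closed S"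
  shows "minimal_bihom_generators (monom_ideal S) ((\<lambda>e. Poly_Mapping.single e 1) ` min_exps S :: 'k::field bipoly set)"
    (is "minimal_bihom_generators _ ?G")
  unfolding minimal_bihom_generators_def
proof (intro conjI ballI allI impI)
  show "\<exists>a b. g \<in> bihom a b" if g: "g \<in> ?G" for g
  proof -
    from g obtain e where "g = Poly_Mapping.single e 1" by blast
    then have "g \<in> bihom (fst (bideg e)) (snd (bideg e))" by (auto intro: bihom_single)
    then show ?thesis by blast
  qed
  show "Idl\<^bsub>bring\<^esub> ?G = monom_ideal S"
    by (simp only: monom_ideal_eq_genideal min_exps_generate[OF assms])
  fix G' assume "G' \<subset> ?G"
  then obtain e where e: "e \<in> min_exps S" "Poly_Mapping.single e 1 \<notin> G'" by blast
  have "G' \<subseteq> (\<lambda>e. Poly_Mapping.single e 1) ` (min_exps S - {e})"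
    using \<open>G' \<subset> ?G\<close> e(2) by blast
  then have sub: "Idl\<^bsub>bring\<^esub> G' \<subseteq> monom_ideal {d + m | d m. m \<in> min_exps S - {e}}"
    unfolding monom_ideal_eq_genideal[symmetric] by (rule genideal_bring_mono)
  \<comment> \<open>A minimal exponent is a multiple of no other minimal exponent, so dropping its
    monomial loses it from the ideal.\<close>
  have "e \<notin> {d + m | d m. m \<in> min_exps S - {e}}"
  proof
    assume "e \<in> {d + m | d m. m \<in> min_exps S - {e}}"
    then obtain d m where "e = d + m" "m \<in> min_exps S" "m \<noteq> e" by blast
    with min_expsD(1)[of m S] min_expsD(2)[of d m S] e(1) show False by auto
  qed
  then have "(Poly_Mapping.single e 1 :: 'k bipoly) \<notin> monom_ideal {d + m | d m. m \<in> min_exps S - {e}}"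
    by (simp add: monom_ideal_def)
  moreover have "(Poly_Mapping.single e 1 :: 'k bipoly) \<in> monom_ideal S"
    using min_expsD(1)[OF e(1)] by (rule single_mem_monom_ideal)
  ultimately show "Idl\<^bsub>bring\<^esub> G' \<noteq> monom_ideal S" using sub by blast
qed

lemma span_subset_genideal: "bvs.span G \<subseteq> Idl\<^bsub>bring\<^esub> G"
proof (rule bvs.span_minimal[OF genideal_bring_self])
  show "bvs.subspace (Idl\<^bsub>bring\<^esub> G)"
    unfolding bvs.subspace_def bscale_def
    using ideal_bringD[OF genideal_bring_ideal[of G]] by blast
qed

text \<open>The coefficient at \<open>e\<close> is a linear functional that vanishes on all the
  other monomials.\<close>

lemma independent_singles:
  "bvs.independent ((\<lambda>e. Poly_Mapping.single e 1) ` M :: 'k::field bipoly set)"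
  unfolding bvs.dependent_def
proof clarify
  fix e assume e: "e \<in> M"
    "(Poly_Mapping.single e 1 :: 'k bipoly) \<in> bvs.span ((\<lambda>e. Poly_Mapping.single e 1) ` M - {Poly_Mapping.single e 1})"
  have "bvs.subspace {f :: 'k bipoly. Poly_Mapping.lookup f e = 0}"
    by (auto simp: bvs.subspace_def bscale_def bconst_mult_lookup lookup_add)
  moreover have "(\<lambda>e. Poly_Mapping.single e 1) ` M - {Poly_Mapping.single e 1} \<subseteq> {f :: 'k bipoly. Poly_Mapping.lookup f e = 0}"
    by (auto simp: lookup_single when_def)
  ultimately have "bvs.span ((\<lambda>e. Poly_Mapping.single e 1) ` M - {Poly_Mapping.single e 1})
      \<subseteq> {f :: 'k bipoly. Poly_Mapping.lookup f e = 0}"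
    by (intro bvs.span_minimal)
  with e show False by auto
qed

lemma inj_single_one: "inj_on (\<lambda>e. Poly_Mapping.single e (1 :: 'k::zero_neq_one)) A"
  by (rule inj_onI) (metis lookup_single_eq lookup_single_not_eq zero_neq_one)

text \<open>Graded Nakayama: restriction to the minimal exponents of one bidegree kills the products
  of the ideal with the irrelevant ideal, so it maps any minimal set of generators of that
  bidegree to a basis.\<close>

lemma card_minimal_generators_monom_ideal:
  fixes G :: "'k::field bipoly set"
  assumes "up_closed S" and G: "minimal_bihom_generators (monom_ideal S) G"
  shows "card (G \<inter> bihom a b) = card {e \<in> min_exps S. bideg e = (a, b)}"
proof -
  define M where "M = {e \<in> min_exps S. bideg e = (a, b)}"
  define B where "B = ((\<lambda>e. Poly_Mapping.single e 1) ` M :: 'k bipoly set)"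
  have M: "finite M" "M \<subseteq> min_exps S"
    by (auto simp: M_def intro: finite_subset[OF _ finite_bideg])
  note lin = restr_linear[OF M(1)]
  have hom: "\<And>g. g \<in> G \<Longrightarrow> \<exists>a b. g \<in> bihom a b" and gen: "Idl\<^bsub>bring\<^esub> G = monom_ideal S"
    and min: "\<And>G'. G' \<subset> G \<Longrightarrow> Idl\<^bsub>bring\<^esub> G' \<noteq> monom_ideal S"
    using G unfolding minimal_bihom_generators_def by blast+
  have GS: "G \<subseteq> monom_ideal S" using genideal_bring_self gen by blast
  define Gab where "Gab = G \<inter> bihom a b"
  have restr_B: "restr M f \<in> bvs.span B" for f
    unfolding restr_def B_def
    by (intro bvs.span_sum) (subst single_eq_bscale, intro bvs.span_scale bvs.span_base imageI)
  have restr_span: "restr M f \<in> bvs.span (restr M ` Gab)" if "f \<in> monom_ideal S" for f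
    using that unfolding gen[symmetric]
  proof (induction rule: genideal_bring_induct)
    case zero
    then show ?case by (simp add: lin bvs.span_zero)
  next
    case (add f g)
    then show ?case by (simp add: lin bvs.span_add)
  next
    case (mult r g)
    then have g: "restr M (r * g) = bscale (Poly_Mapping.lookup r 0) (restr M g)"
      using GS M by (intro restr_min_exps_mult) auto
    show ?case
    proof (cases "g \<in> bihom a b")
      case True
      with mult show ?thesis unfolding g Gab_def
        by (intro bvs.span_scale bvs.span_base) blast
    next
      case False
      obtain c d where "g \<in> bihom c d" using hom mult by blast
      with False have "Poly_Mapping.keys g \<inter> M = {}"
        by (auto simp: bihom_eq M_def)
      then have "restr M g = 0" by (rule restr_0[OF M(1)])
      then show ?thesis unfolding g by (simp add: bvs.span_zero)
    qed
  qed
  \<comment> \<open>Restrictions are combinations of minimal monomials; conversely each minimal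
    monomial lies in the ideal and is its own restriction.\<close>
  have B_span: "bvs.span (restr M ` Gab) = bvs.span B"
  proof
    show "bvs.span (restr M ` Gab) \<subseteq> bvs.span B"
      by (rule bvs.span_minimal) (use restr_B in \<open>auto simp: bvs.subspace_span\<close>)
    show "bvs.span B \<subseteq> bvs.span (restr M ` Gab)"
    proof (rule bvs.span_minimal[OF _ bvs.subspace_span])
      show "B \<subseteq> bvs.span (restr M ` Gab)"
      proof
        fix f assume "f \<in> B"
        then obtain e where e: "e \<in> M" "f = Poly_Mapping.single e 1" by (auto simp: B_def)
        then have "f \<in> monom_ideal S" using M(2) min_expsD(1) by (blast intro: single_mem_monom_ideal)
        moreover have "restr M f = f" using e by (intro restr_id[OF M(1)]) auto
        ultimately show "f \<in> bvs.span (restr M ` Gab)" using restr_span[of f] by simp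
      qed
    qed
  qed
  \<comment> \<open>Otherwise \<open>g\<close> would differ from a combination \<open>k\<close> of
    the other generators of its bidegree by some \<open>h\<close> without minimal exponents. Such an
    \<open>h\<close> is already generated without bidegree (a, b), so \<open>g\<close> would be
    redundant.\<close>
  have indep: "restr M g \<notin> bvs.span (restr M ` (Gab - {g}))" if g: "g \<in> Gab" for g
  proof
    interpret l: Vector_Spaces.linear bscale bscale "restr M"
      by unfold_locales (simp_all add: lin)
    let ?G' = "Gab - {g}"
    assume "restr M g \<in> bvs.span (restr M ` ?G')"
    then obtain k where k: "k \<in> bvs.span ?G'" "restr M g = restr M k"
      unfolding l.span_image by blast
    define h where "h = g - k"
    note I = ideal_bringD[OF genideal_bring_ideal[of "G - {g}"]]
    have kI: "k \<in> Idl\<^bsub>bring\<^esub> (G - {g})"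
      using k(1) span_subset_genideal[of ?G'] genideal_bring_mono[of ?G' "G - {g}"]
      by (auto simp: Gab_def)
    have kab: "k \<in> bihom a b"
    proof -
      have "bvs.subspace (bihom a b)"
        by (simp add: bvs.subspace_def bihom_zero bihom_add bihom_bscale)
      then have "bvs.span ?G' \<subseteq> bihom a b" by (intro bvs.span_minimal) (auto simp: Gab_def)
      with k(1) show ?thesis by blast
    qed
    have gS: "g \<in> monom_ideal S" using g GS by (auto simp: Gab_def)
    have kS: "k \<in> monom_ideal S"
      using kI genideal_bring_mono[of "G - {g}" G] gen by auto
    have "h \<in> monom_ideal S"
      unfolding h_def using gS kS ideal_bringD(4)[OF monom_ideal_ideal[OF assms(1)]] by blast
    moreover have "h \<in> bihom a b"
      using bihom_add[OF _ bihom_bscale[OF kab, of "-1"], of g] g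
      by (simp add: h_def Gab_def bscale_def bconst_simps)
    ultimately have keys_h: "e \<in> S" "bideg e = (a, b)" if "e \<in> Poly_Mapping.keys h" for e
      using that by (auto simp: monom_ideal_def bihom_eq)
    have "restr M h = 0" using k(2) by (simp add: h_def lin)
    have single_I: "Poly_Mapping.single e c \<in> Idl\<^bsub>bring\<^esub> (G - {g})"
      if e: "e \<in> Poly_Mapping.keys h" for e c
    proof -
      have "e \<notin> M"
        using \<open>restr M h = 0\<close> e lookup_restr[OF M(1), of h e] by (auto simp: in_keys_iff)
      then have "e \<notin> min_exps S" using keys_h[OF e] by (simp add: M_def)
      then obtain d e' where e': "e' \<in> S" "e = d + e'" "d \<noteq> 0"
        using keys_h(1)[OF e] unfolding min_exps_def by blast
      \<comment> \<open>Since \<open>d\<close> is nonzero, the bidegree of \<open>e'\<close> is not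
        at or above (a, b), and its monomial is obtained without the generators of bidegree (a,
        b).\<close>
      have "bideg d \<noteq> (0, 0)" using e'(3) bideg_eq_0_iff by blast
      moreover have "fst (bideg d) + fst (bideg e') = a" "snd (bideg d) + snd (bideg e') = b"
        using keys_h(2)[OF e] by (auto simp: e'(2) prod_eq_iff)
      ultimately have "\<not> (a \<le> fst (bideg e') \<and> b \<le> snd (bideg e'))"
        by (auto simp: prod_eq_iff)
      moreover have "Poly_Mapping.single e' 1 \<in> Idl\<^bsub>bring\<^esub> G"
        unfolding gen using e'(1) by (rule single_mem_monom_ideal)
      ultimately have "restr {m. bideg m = (fst (bideg e'), snd (bideg e'))} (Poly_Mapping.single e' 1)
          \<in> Idl\<^bsub>bring\<^esub> (G - bihom a b)"
        using hom by (intro genideal_restr_bideg)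
      moreover have "restr {m. bideg m = (fst (bideg e'), snd (bideg e'))} (Poly_Mapping.single e' 1)
          = (Poly_Mapping.single e' 1 :: 'k bipoly)"
        by (intro restr_id[OF finite_bideg]) auto
      moreover have "Idl\<^bsub>bring\<^esub> (G - bihom a b) \<subseteq> Idl\<^bsub>bring\<^esub> (G - {g})"
        using g by (intro genideal_bring_mono) (auto simp: Gab_def)
      ultimately have "Poly_Mapping.single e' 1 \<in> Idl\<^bsub>bring\<^esub> (G - {g})" by auto
      then have "Poly_Mapping.single d c * Poly_Mapping.single e' 1 \<in> Idl\<^bsub>bring\<^esub> (G - {g})" by (rule I)
      then show ?thesis by (simp add: mult_single e'(2))
    qed
    have "(\<Sum>e\<in>Poly_Mapping.keys h. Poly_Mapping.single e (Poly_Mapping.lookup h e)) \<in> Idl\<^bsub>bring\<^esub> (G - {g})"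
      by (intro I single_I)
    then have "h \<in> Idl\<^bsub>bring\<^esub> (G - {g})"
      by (simp flip: poly_mapping_eq_sum_single[of "Poly_Mapping.keys h" h])
    with kI have "h + k \<in> Idl\<^bsub>bring\<^esub> (G - {g})" by (intro I)
    then have "g \<in> Idl\<^bsub>bring\<^esub> (G - {g})" by (simp add: h_def)
    then have "G \<subseteq> Idl\<^bsub>bring\<^esub> (G - {g})" using genideal_bring_self[of "G - {g}"] by blast
    then have "Idl\<^bsub>bring\<^esub> (G - {g}) = monom_ideal S"
      using genideal_bring_minimal[OF genideal_bring_ideal] genideal_bring_mono[of "G - {g}" G] gen by blast
    moreover have "G - {g} \<subset> G" using g by (auto simp: Gab_def)
    ultimately show False using min by blast
  qed
  have inj: "inj_on (restr M) Gab"
  proof (rule inj_onI, rule ccontr)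
    fix f g assume "f \<in> Gab" "g \<in> Gab" "restr M f = restr M g" "f \<noteq> g"
    then have "restr M f \<in> bvs.span (restr M ` (Gab - {f}))" by (auto intro: bvs.span_base)
    with indep \<open>f \<in> Gab\<close> show False by blast
  qed
  have "bvs.independent (restr M ` Gab)"
    unfolding bvs.dependent_def
  proof clarify
    fix g assume g: "g \<in> Gab" "restr M g \<in> bvs.span (restr M ` Gab - {restr M g})"
    moreover have "restr M ` Gab - {restr M g} \<subseteq> restr M ` (Gab - {g})" by auto
    ultimately show False using indep bvs.span_mono by blast
  qed
  then have "card (restr M ` Gab) = bvs.dim (bvs.span B)"
    using bvs.dim_eq_card[of "restr M ` Gab" "bvs.span B"] B_span by (simp add: bvs.span_span)
  also have "\<dots> = card B"
    using independent_singles[of M, where 'k = 'k, folded B_def] by (simp add: bvs.dim_span bvs.dim_eq_card_independent)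
  also have "\<dots> = card M" unfolding B_def by (rule card_image[OF inj_single_one])
  finally show ?thesis unfolding card_image[OF inj] unfolding Gab_def M_def .
qed

text \<open>The monomial generators give existence, with finiteness because a bidegree has finitely
  many exponents; the count for arbitrary minimal generating sets gives uniqueness.\<close>

lemma betti0_monom_ideal:
  assumes "up_closed S"
  shows "betti0 (monom_ideal S :: 'k::field bipoly set) a b = card {e \<in> min_exps S. bideg e = (a, b)}"
  unfolding betti0_def
proof (rule the_equality)
  let ?G = "(\<lambda>e. Poly_Mapping.single e 1) ` min_exps S :: 'k bipoly set"
  have "?G \<inter> bihom a b \<subseteq> (\<lambda>e. Poly_Mapping.single e 1) ` {e. bideg e = (a, b)}"
    by (auto simp: bihom_eq)
  then have "finite (?G \<inter> bihom a b)"
    by (rule finite_subset) (intro finite_imageI finite_bideg)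
  with minimal_bihom_generators_monom_ideal[OF assms, where 'k = 'k]
    card_minimal_generators_monom_ideal[OF assms minimal_bihom_generators_monom_ideal[OF assms, where 'k = 'k]]
  show "\<exists>G. minimal_bihom_generators (monom_ideal S :: 'k bipoly set) G \<and> finite (G \<inter> bihom a b) \<and>
      card (G \<inter> bihom a b) = card {e \<in> min_exps S. bideg e = (a, b)}"
    by blast
qed (use card_minimal_generators_monom_ideal[OF assms] in blast)

section \<open>Graded automorphisms\<close>

definition pvar :: "4 \<Rightarrow> 'k::field bipoly" where
  "pvar i = Poly_Mapping.single (Poly_Mapping.single i 1) 1"

section \<open>Products and powers of monomial ideals\<close>

lemma ideal_prod_monom_ideal:
  assumes "up_closed S" "up_closed T"
  shows "ideal_prod bring (monom_ideal S) (monom_ideal T) = (monom_ideal {d + e | d e. d \<in> S \<and> e \<in> T} :: 'k::field bipoly set)"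
    (is "?P = monom_ideal ?U")
proof
  show "?P \<subseteq> monom_ideal ?U"
  proof
    fix f assume "f \<in> ?P"
    then show "f \<in> monom_ideal ?U"
    proof (induction rule: ideal_prod.induct)
      case (prod i j)
      then show ?case using keys_mult[of i j] by (fastforce simp: monom_ideal_def)
    next
      case (sum f g)
      then show ?case using Poly_Mapping.keys_add[of f g] by (auto simp: monom_ideal_def)
    qed
  qed
  show "monom_ideal ?U \<subseteq> ?P"
  proof
    fix f :: "'k bipoly" assume f: "f \<in> monom_ideal ?U"
    note I = ideal_bringD[OF ring.ideal_prod_is_ideal[OF ring_bring
      monom_ideal_ideal[OF assms(1)] monom_ideal_ideal[OF assms(2)]]]
    have "Poly_Mapping.single e c \<in> ?P" if "e \<in> Poly_Mapping.keys f" for e c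
    proof -
      from that f obtain s t where "e = s + t" "s \<in> S" "t \<in> T" by (auto simp: monom_ideal_def)
      then have "Poly_Mapping.single e c = Poly_Mapping.single s c \<otimes>\<^bsub>bring\<^esub> Poly_Mapping.single t 1"
        "Poly_Mapping.single s c \<in> monom_ideal S" "Poly_Mapping.single t (1::'k) \<in> monom_ideal T"
        by (simp_all add: mult_single single_mem_monom_ideal)
      then show ?thesis by (simp only: ideal_prod.prod)
    qed
    then have "(\<Sum>e\<in>Poly_Mapping.keys f. Poly_Mapping.single e (Poly_Mapping.lookup f e)) \<in> ?P"
      by (intro I)
    then show "f \<in> ?P"
      by (simp flip: poly_mapping_eq_sum_single[of "Poly_Mapping.keys f" f])
  qed
qed

lemma ideal_power_simps:
  "ideal_power I 0 = UNIV" "ideal_power I (Suc m) = ideal_prod bring (ideal_power I m) I"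
  by (simp_all add: ideal_power_def nat_pow_def ideals_set_def)

lemma exps_minus_single:
  fixes e :: "4 \<Rightarrow>\<^sub>0 nat"
  assumes "1 \<le> Poly_Mapping.lookup e i"
  shows "e = (e - Poly_Mapping.single i 1) + Poly_Mapping.single i 1"
  by (rule poly_mapping_eqI) (use assms in \<open>auto simp: lookup_add lookup_minus lookup_single when_def\<close>)

text \<open>An exponent of weight at least m + 1 in the variables i and j contains one of them, and
  removing it leaves weight at least m. The indices must differ: for \<open>i = j\<close> the weight
  would count each factor twice.\<close>

lemma ideal_power_pvar:
  assumes "i \<noteq> j"
  shows "ideal_power (Idl\<^bsub>bring\<^esub> {pvar i, pvar j}) m =
    monom_ideal {e. m \<le> Poly_Mapping.lookup e i + Poly_Mapping.lookup e j}"
proof -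
  let ?T = "\<lambda>m. {e :: 4 \<Rightarrow>\<^sub>0 nat. m \<le> Poly_Mapping.lookup e i + Poly_Mapping.lookup e j}"
  have up: "up_closed (?T m)" for m by (auto simp: up_closed_def lookup_add)
  have step: "{d + e | d e. d \<in> ?T m \<and> e \<in> {Poly_Mapping.single i 1, Poly_Mapping.single j 1}} = ?T (Suc m)" for m
  proof (intro Set.set_eqI iffI)
    fix e assume "e \<in> {d + e | d e. d \<in> ?T m \<and> e \<in> {Poly_Mapping.single i 1, Poly_Mapping.single j 1}}"
    then show "e \<in> ?T (Suc m)" using assms by (auto simp: lookup_add lookup_single when_def)
  next
    fix e assume e: "e \<in> ?T (Suc m)"
    then have "1 \<le> Poly_Mapping.lookup e i \<or> 1 \<le> Poly_Mapping.lookup e j" by auto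
    then show "e \<in> {d + e | d e. d \<in> ?T m \<and> e \<in> {Poly_Mapping.single i 1, Poly_Mapping.single j 1}}"
    proof
      assume "1 \<le> Poly_Mapping.lookup e i"
      moreover have "e - Poly_Mapping.single i 1 \<in> ?T m"
        using e assms by (auto simp: lookup_minus lookup_single when_def)
      ultimately show ?thesis using exps_minus_single by blast
    next
      assume "1 \<le> Poly_Mapping.lookup e j"
      moreover have "e - Poly_Mapping.single j 1 \<in> ?T m"
        using e assms by (auto simp: lookup_minus lookup_single when_def)
      ultimately show ?thesis using exps_minus_single by blast
    qed
  qed
  \<comment> \<open>This is \<open>step\<close> at 0, where \<open>?T 0\<close> contains every
    exponent.\<close>
  have T1: "Idl\<^bsub>bring\<^esub> {pvar i, pvar j} = monom_ideal (?T 1)"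
    using monom_ideal_eq_genideal[of "{Poly_Mapping.single i 1, Poly_Mapping.single j 1}"] step[of 0]
    by (simp add: pvar_def)
  show ?thesis
  proof (induction m)
    case 0
    then show ?case by (simp add: ideal_power_simps monom_ideal_def)
  next
    case (Suc m)
    have "{d + e | d e. d \<in> ?T m \<and> e \<in> ?T 1} = ?T (Suc m)"
    proof
      show "{d + e | d e. d \<in> ?T m \<and> e \<in> ?T 1} \<subseteq> ?T (Suc m)" by (auto simp: lookup_add)
      have "{Poly_Mapping.single i 1, Poly_Mapping.single j 1} \<subseteq> ?T 1" by (simp add: lookup_single)
      then show "?T (Suc m) \<subseteq> {d + e | d e. d \<in> ?T m \<and> e \<in> ?T 1}"
        unfolding step[of m, symmetric] by blast
    qed
    then show ?case
      unfolding ideal_power_simps Suc unfolding T1 ideal_prod_monom_ideal[OF up up] by simp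
  qed
qed

section \<open>Transport along graded automorphisms\<close>

locale graded_automorphism =
  fixes \<phi> \<psi> :: "'k::field bipoly \<Rightarrow> 'k bipoly"
  assumes hom_add: "\<phi> (f + g) = \<phi> f + \<phi> g"
    and hom_mult: "\<phi> (f * g) = \<phi> f * \<phi> g"
    and hom_bconst: "\<phi> (bconst c) = bconst c"
    and inv_hom: "\<psi> (\<phi> f) = f" and hom_inv: "\<phi> (\<psi> f) = f"
    and hom_bihom: "f \<in> bihom a b \<Longrightarrow> \<phi> f \<in> bihom a b"
    and inv_bihom: "f \<in> bihom a b \<Longrightarrow> \<psi> f \<in> bihom a b"
begin

text \<open>The inverse map is a parameter of the locale so that the locale applies with both maps
  exchanged; inclusions between images then become equalities.\<close>

lemma inverse: "graded_automorphism \<psi> \<phi>"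
proof
  show "\<psi> (f + g) = \<psi> f + \<psi> g" for f g by (metis hom_add inv_hom hom_inv)
  show "\<psi> (f * g) = \<psi> f * \<psi> g" for f g by (metis hom_mult inv_hom hom_inv)
  show "\<psi> (bconst c) = bconst c" for c by (metis hom_bconst inv_hom)
qed (simp_all add: inv_hom hom_inv hom_bihom inv_bihom)

lemma image_inv: "\<psi> ` \<phi> ` A = A" by (auto simp: inv_hom image_iff)

lemma inj: "inj_on \<phi> A" by (metis inj_onI inv_hom)

lemma mem_image_iff: "f \<in> \<phi> ` A \<longleftrightarrow> \<psi> f \<in> A"
  by (metis hom_inv image_eqI imageE inv_hom)

lemma hom_zero: "\<phi> 0 = 0" and hom_one: "\<phi> 1 = 1"
  using hom_bconst[of 0] hom_bconst[of 1] by (simp_all add: bconst_simps)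

lemma hom_sum: "\<phi> (sum f A) = (\<Sum>i\<in>A. \<phi> (f i))"
  by (induction A rule: infinite_finite_induct) (simp_all add: hom_zero hom_add)

lemma hom_bscale: "\<phi> (bscale c f) = bscale c (\<phi> f)"
  by (simp add: bscale_def hom_mult hom_bconst)

lemma ideal_image:
  assumes "ideal I bring"
  shows "ideal (\<phi> ` I) bring"
proof (rule ideal_bringI)
  note I = ideal_bringD[OF assms]
  have "\<phi> 0 \<in> \<phi> ` I" by (rule imageI[OF I(1)])
  then show "0 \<in> \<phi> ` I" by (simp add: hom_zero)
  show "x + y \<in> \<phi> ` I" if xy: "x \<in> \<phi> ` I" "y \<in> \<phi> ` I" for x y
  proof -
    from xy obtain f g where fg: "x = \<phi> f" "f \<in> I" "y = \<phi> g" "g \<in> I" by blast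
    then have "\<phi> (f + g) \<in> \<phi> ` I" by (intro imageI I(2))
    then show ?thesis by (simp add: fg hom_add)
  qed
  show "r * x \<in> \<phi> ` I" if x: "x \<in> \<phi> ` I" for r x
  proof -
    from x obtain f where f: "x = \<phi> f" "f \<in> I" by blast
    then have "\<phi> (\<psi> r * f) \<in> \<phi> ` I" by (intro imageI I(3))
    then show ?thesis by (simp add: f hom_mult hom_inv)
  qed
qed

lemma genideal_image_subset: "Idl\<^bsub>bring\<^esub> (\<phi> ` G) \<subseteq> \<phi> ` (Idl\<^bsub>bring\<^esub> G)"
  by (intro genideal_bring_minimal ideal_image genideal_bring_ideal image_mono genideal_bring_self)

lemma ideal_prod_image_subset: "\<phi> ` ideal_prod bring I J \<subseteq> ideal_prod bring (\<phi> ` I) (\<phi> ` J)"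
proof clarify
  fix f assume "f \<in> ideal_prod bring I J"
  then show "\<phi> f \<in> ideal_prod bring (\<phi> ` I) (\<phi> ` J)"
  proof (induction rule: ideal_prod.induct)
    case (prod i j)
    then have "\<phi> i \<otimes>\<^bsub>bring\<^esub> \<phi> j \<in> ideal_prod bring (\<phi> ` I) (\<phi> ` J)"
      by (intro ideal_prod.prod imageI)
    then show ?case by (simp add: hom_mult)
  next
    case (sum f g)
    then have "\<phi> f \<oplus>\<^bsub>bring\<^esub> \<phi> g \<in> ideal_prod bring (\<phi> ` I) (\<phi> ` J)"
      by (intro ideal_prod.sum)
    then show ?case by (simp add: hom_add)
  qed
qed

end

context graded_automorphism
begin

interpretation inv: graded_automorphism \<psi> \<phi> by (rule inverse)

text \<open>The inclusion for \<open>\<psi>\<close>, used on the image of \<open>G\<close> and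
  carried back by \<open>\<phi>\<close>, is the converse inclusion.\<close>

lemma genideal_image: "Idl\<^bsub>bring\<^esub> (\<phi> ` G) = \<phi> ` (Idl\<^bsub>bring\<^esub> G)"
proof
  have "\<phi> ` (Idl\<^bsub>bring\<^esub> (\<psi> ` \<phi> ` G)) \<subseteq> \<phi> ` \<psi> ` (Idl\<^bsub>bring\<^esub> (\<phi> ` G))"
    by (intro image_mono inv.genideal_image_subset)
  then show "\<phi> ` (Idl\<^bsub>bring\<^esub> G) \<subseteq> Idl\<^bsub>bring\<^esub> (\<phi> ` G)"
    by (simp only: image_inv inv.image_inv)
qed (rule genideal_image_subset)

lemma ideal_prod_image: "ideal_prod bring (\<phi> ` I) (\<phi> ` J) = \<phi> ` ideal_prod bring I J"
proof
  have "\<phi> ` \<psi> ` ideal_prod bring (\<phi> ` I) (\<phi> ` J) \<subseteq> \<phi> ` ideal_prod bring (\<psi> ` \<phi> ` I) (\<psi> ` \<phi> ` J)"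
    by (intro image_mono inv.ideal_prod_image_subset)
  then show "ideal_prod bring (\<phi> ` I) (\<phi> ` J) \<subseteq> \<phi> ` ideal_prod bring I J"
    by (simp only: image_inv inv.image_inv)
qed (rule ideal_prod_image_subset)

lemma ideal_power_image: "ideal_power (\<phi> ` I) m = \<phi> ` ideal_power I m"
proof (induction m)
  case 0
  show ?case by (auto simp: ideal_power_simps mem_image_iff)
qed (simp add: ideal_power_simps ideal_prod_image)

lemma fat_ideal_image:
  "fat_ideal (\<phi> H1) (\<phi> H2) (\<phi> V1) (\<phi> V2) m11 m12 m21 = \<phi> ` fat_ideal H1 H2 V1 V2 m11 m12 m21"
proof -
  have "point_ideal (\<phi> H) (\<phi> V) = \<phi> ` point_ideal H V" for H V
    using genideal_image[of "{H, V}"] by (simp add: point_ideal_def)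
  then show ?thesis
    by (simp add: fat_ideal_def ideal_power_image image_Int[OF inj])
qed

lemma image_bihom: "\<phi> ` bihom a b = bihom a b"
  by (auto simp: mem_image_iff inv_bihom hom_bihom)

lemma minimal_bihom_generators_image:
  assumes "minimal_bihom_generators I G"
  shows "minimal_bihom_generators (\<phi> ` I) (\<phi> ` G)"
  unfolding minimal_bihom_generators_def
proof (intro conjI ballI allI impI)
  have hom: "\<And>g. g \<in> G \<Longrightarrow> \<exists>a b. g \<in> bihom a b" and gen: "Idl\<^bsub>bring\<^esub> G = I"
    and min: "\<And>G'. G' \<subset> G \<Longrightarrow> Idl\<^bsub>bring\<^esub> G' \<noteq> I"
    using assms unfolding minimal_bihom_generators_def by blast+
  show "\<exists>a b. g \<in> bihom a b" if "g \<in> \<phi> ` G" for g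
  proof -
    from that obtain f where "g = \<phi> f" "f \<in> G" by blast
    with hom[of f] hom_bihom[of f] show ?thesis by blast
  qed
  show "Idl\<^bsub>bring\<^esub> (\<phi> ` G) = \<phi> ` I" by (simp add: genideal_image gen)
  fix G' assume G': "G' \<subset> \<phi> ` G"
  have "\<psi> ` G' \<subset> G"
  proof (rule psubsetI)
    show "\<psi> ` G' \<subseteq> G"
      using image_mono[of G' "\<phi> ` G" \<psi>] G' by (simp add: image_inv psubset_eq)
    show "\<psi> ` G' \<noteq> G" using G' inv.image_inv[of G'] by auto
  qed
  from min[OF this] show "Idl\<^bsub>bring\<^esub> G' \<noteq> \<phi> ` I"
    using graded_automorphism.genideal_image[OF inverse, of G'] image_inv[of I] by auto
qed

text \<open>Minimal generating sets of the two ideals correspond under \<open>\<phi>\<close>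
  bidegree by bidegree, so both definite descriptions have the same defining property.\<close>

lemma betti0_image: "betti0 (\<phi> ` I) a b = betti0 I a b"
proof -
  have card: "card (\<phi> ` G \<inter> bihom a b) = card (G \<inter> bihom a b)"
    "finite (\<phi> ` G \<inter> bihom a b) \<longleftrightarrow> finite (G \<inter> bihom a b)" for G
  proof -
    have "\<phi> ` G \<inter> bihom a b = \<phi> ` (G \<inter> bihom a b)"
      by (simp add: image_Int[OF inj] image_bihom)
    then show "card (\<phi> ` G \<inter> bihom a b) = card (G \<inter> bihom a b)"
      "finite (\<phi> ` G \<inter> bihom a b) \<longleftrightarrow> finite (G \<inter> bihom a b)"
      by (simp_all add: card_image[OF inj] finite_image_iff[OF inj])
  qed
  have "minimal_bihom_generators (\<phi> ` I) (\<phi> ` G) \<longleftrightarrow> minimal_bihom_generators I G" for G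
    using minimal_bihom_generators_image[of I G]
      graded_automorphism.minimal_bihom_generators_image[OF inverse, of "\<phi> ` I" "\<phi> ` G"]
    by (auto simp: image_inv)
  note iff = this card
  have "(\<exists>G. minimal_bihom_generators (\<phi> ` I) G \<and> finite (G \<inter> bihom a b) \<and> card (G \<inter> bihom a b) = n) \<longleftrightarrow>
    (\<exists>G. minimal_bihom_generators I G \<and> finite (G \<inter> bihom a b) \<and> card (G \<inter> bihom a b) = n)"
    (is "(\<exists>G. ?P (\<phi> ` I) G) \<longleftrightarrow> (\<exists>G. ?P I G)") for n
  proof
    assume "\<exists>G. ?P (\<phi> ` I) G"
    then obtain G where "?P (\<phi> ` I) G" by blast
    then have "?P (\<phi> ` I) (\<phi> ` \<psi> ` G)" by (simp only: inv.image_inv)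
    then have "?P I (\<psi> ` G)" by (simp only: iff)
    then show "\<exists>G. ?P I G" by blast
  next
    assume "\<exists>G. ?P I G"
    then obtain G where "?P I G" by blast
    then have "?P (\<phi> ` I) (\<phi> ` G)" by (simp only: iff)
    then show "\<exists>G. ?P (\<phi> ` I) G" by blast
  qed
  then show ?thesis by (simp add: betti0_def)
qed

text \<open>The images of the monomials outside \<open>S\<close> represent a basis of the quotient
  in bidegree (a, b). The assumption \<open>0 \<notin> S\<close> says that the ideal is
  proper.\<close>

lemma hilbert_image_monom_ideal:
  assumes "up_closed S" "0 \<notin> S"
  shows "hilbert (\<phi> ` monom_ideal S) (int a) (int b) = int (card {e. bideg e = (a, b) \<and> e \<notin> S})"
proof (rule hilbert_eq_card[where u = "\<lambda>e. \<phi> (Poly_Mapping.single e 1)"])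
  let ?E = "{e. bideg e = (a, b) \<and> e \<notin> S}"
  show fin: "finite ?E" by (rule finite_subset[OF _ finite_bideg]) auto
  have comb: "(\<Sum>e\<in>?E. bscale (c e) (\<phi> (Poly_Mapping.single e 1))) = \<phi> (\<Sum>e\<in>?E. Poly_Mapping.single e (c e))" for c
    by (simp add: hom_sum single_eq_bscale[of _ "c _"] hom_bscale)
  show "ideal (\<phi> ` monom_ideal S) bring"
    by (intro ideal_image monom_ideal_ideal assms)
  show "1 \<notin> \<phi> ` monom_ideal S"
    using assms(2) by (simp add: mem_image_iff inv.hom_one monom_ideal_def)
  show "(\<Sum>e\<in>?E. bscale (c e) (\<phi> (Poly_Mapping.single e 1))) \<in> bihom a b" for c
    unfolding comb by (intro hom_bihom bihom_sum bihom_single) auto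
  show "c e = 0" if "(\<Sum>e\<in>?E. bscale (c e) (\<phi> (Poly_Mapping.single e 1))) \<in> \<phi> ` monom_ideal S"
    and "e \<in> ?E" for c e
  proof -
    have "Poly_Mapping.keys (\<Sum>e\<in>?E. Poly_Mapping.single e (c e)) \<subseteq> S"
      using that(1) by (simp add: comb mem_image_iff inv_hom monom_ideal_def)
    then have "Poly_Mapping.lookup (\<Sum>e\<in>?E. Poly_Mapping.single e (c e)) e = 0"
      using that(2) by (auto simp: in_keys_iff)
    then show ?thesis using that(2) fin by (simp add: lookup_sum lookup_single when_def)
  qed
  show "\<exists>c. p - (\<Sum>e\<in>?E. bscale (c e) (\<phi> (Poly_Mapping.single e 1))) \<in> \<phi> ` monom_ideal S"
    if "p \<in> bihom a b" for p
  proof (intro exI)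
    let ?c = "Poly_Mapping.lookup (\<psi> p)"
    have "\<psi> p \<in> bihom a b" using that by (rule inv_bihom)
    then have "Poly_Mapping.keys (\<psi> p - restr ?E (\<psi> p)) \<subseteq> S"
      by (auto simp: bihom_eq in_keys_iff lookup_minus lookup_restr[OF fin] split: if_splits)
    moreover have "\<psi> (f - g) = \<psi> f - \<psi> g" for f g
      using inv.hom_add[of "f - g" g] by simp
    ultimately show "p - (\<Sum>e\<in>?E. bscale (?c e) (\<phi> (Poly_Mapping.single e 1))) \<in> \<phi> ` monom_ideal S"
      unfolding comb mem_image_iff by (simp add: inv_hom monom_ideal_def restr_def)
  qed
qed

end

section \<open>Linear change of coordinates\<close>

definition ppow :: "(4 \<Rightarrow> 'k::field bipoly) \<Rightarrow> (4 \<Rightarrow>\<^sub>0 nat) \<Rightarrow> 'k bipoly" where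
  "ppow v e = v 0 ^ Poly_Mapping.lookup e 0 * v 1 ^ Poly_Mapping.lookup e 1
     * (v 2 ^ Poly_Mapping.lookup e 2 * v 3 ^ Poly_Mapping.lookup e 3)"

definition psubst :: "(4 \<Rightarrow> 'k::field bipoly) \<Rightarrow> 'k bipoly \<Rightarrow> 'k bipoly" where
  "psubst v f = (\<Sum>e\<in>Poly_Mapping.keys f. bscale (Poly_Mapping.lookup f e) (ppow v e))"

lemma ppow_0: "ppow v 0 = 1" and ppow_add: "ppow v (d + e) = ppow v d * ppow v e"
  by (simp_all add: ppow_def lookup_add power_add mult_ac)

lemma psubst_superset:
  assumes "finite A" "Poly_Mapping.keys f \<subseteq> A"
  shows "psubst v f = (\<Sum>e\<in>A. bscale (Poly_Mapping.lookup f e) (ppow v e))"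
  unfolding psubst_def
  by (rule sum.mono_neutral_left) (use assms in \<open>auto simp: in_keys_iff\<close>)

lemma psubst_single: "psubst v (Poly_Mapping.single e c) = bscale c (ppow v e)"
  by (subst psubst_superset[of "{e}"]) auto

lemma psubst_add: "psubst v (f + g) = psubst v f + psubst v g"
proof -
  let ?A = "Poly_Mapping.keys f \<union> Poly_Mapping.keys g"
  have "psubst v h = (\<Sum>e\<in>?A. bscale (Poly_Mapping.lookup h e) (ppow v e))" if "h \<in> {f, g, f + g}" for h
    using that Poly_Mapping.keys_add[of f g] by (intro psubst_superset) auto
  then show ?thesis
    by (simp add: lookup_add bvs.scale_left_distrib sum.distrib)
qed

lemma psubst_0: "psubst v 0 = 0"
  by (simp add: psubst_def)

lemma psubst_mult: "psubst v (f * g) = psubst v f * psubst v g"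
proof (induction f rule: poly_mapping_induct_single)
  case (single d x)
  show ?case
  proof (induction g rule: poly_mapping_induct_single)
    case (single e y)
    show ?case
      by (simp add: mult_single psubst_single ppow_add bscale_def bconst_simps mult_ac)
  qed (simp_all add: psubst_0 psubst_add distrib_left)
qed (simp_all add: psubst_0 psubst_add distrib_right)

lemma psubst_bconst: "psubst v (bconst c) = bconst c"
  by (simp add: bconst_def psubst_single ppow_0 bscale_def)

lemma psubst_bscale: "psubst v (bscale c f) = bscale c (psubst v f)"
  by (simp add: bscale_def psubst_mult psubst_bconst)

lemma psubst_power: "psubst v (f ^ n) = psubst v f ^ n"
  using psubst_bconst[of v 1] by (induction n) (simp_all add: psubst_mult bconst_simps)

lemma psubst_pvar: "psubst v (pvar i) = v i"
  using exhaust_4[of i]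
  by (auto simp: pvar_def psubst_single ppow_def lookup_single)

lemma ppow_pvar: "ppow pvar e = (Poly_Mapping.single e 1 :: 'k::field bipoly)"
proof -
  have "pvar i ^ n = (Poly_Mapping.single (Poly_Mapping.single i n) 1 :: 'k bipoly)" for i n
    by (induction n) (simp_all add: pvar_def mult_single flip: single_add)
  then have "(ppow pvar e :: 'k bipoly) = Poly_Mapping.single (exps (Poly_Mapping.lookup e 0) (Poly_Mapping.lookup e 1)
     (Poly_Mapping.lookup e 2) (Poly_Mapping.lookup e 3)) 1"
    unfolding ppow_def exps_def by (simp add: mult_single add.assoc)
  then show ?thesis by simp
qed

text \<open>A composite of substitutions is k-linear and multiplicative, hence determined by its
  values at the variables.\<close>

lemma psubst_psubst:
  assumes "\<And>i. psubst w (v i) = pvar i"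
  shows "psubst w (psubst v f) = f"
proof (induction f rule: poly_mapping_induct_single)
  case (single e c)
  have "psubst w (ppow v e) = ppow pvar e"
    by (simp add: ppow_def psubst_mult psubst_power assms)
  then show ?case
    by (simp add: psubst_single psubst_bscale ppow_pvar flip: single_eq_bscale)
qed (simp_all add: psubst_0 psubst_add)

lemma bihom_power: "f \<in> bihom a b \<Longrightarrow> f ^ n \<in> bihom (n * a) (n * b)"
proof (induction n)
  case 0
  show ?case using bihom_bconst[of 1] by (simp add: bconst_simps)
qed (simp add: bihom_mult)

lemma psubst_bihom:
  assumes "v 0 \<in> bihom 1 0" "v 1 \<in> bihom 1 0" "v 2 \<in> bihom 0 1" "v 3 \<in> bihom 0 1" "f \<in> bihom a b"
  shows "psubst v f \<in> bihom a b"
  unfolding psubst_def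
proof (intro bihom_sum bihom_bscale)
  fix e assume "e \<in> Poly_Mapping.keys f"
  with assms(5) have "bideg e = (a, b)" by (simp add: bihom_eq)
  \<comment> \<open>The degrees are left unsimplified, in the form that \<open>bihom_mult\<close>
    and \<open>bihom_power\<close> yield for the bracketing of \<open>ppow\<close>.\<close>
  moreover have "ppow v e \<in> bihom
      (Poly_Mapping.lookup e 0 * 1 + Poly_Mapping.lookup e 1 * 1 + (Poly_Mapping.lookup e 2 * 0 + Poly_Mapping.lookup e 3 * 0))
      (Poly_Mapping.lookup e 0 * 0 + Poly_Mapping.lookup e 1 * 0 + (Poly_Mapping.lookup e 2 * 1 + Poly_Mapping.lookup e 3 * 1))"
    unfolding ppow_def by (intro bihom_mult bihom_power assms)
  ultimately show "ppow v e \<in> bihom a b" by (simp add: bideg_def)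
qed

lemma pvar_bihom: "pvar 0 \<in> bihom 1 0" "pvar 1 \<in> bihom 1 0" "pvar 2 \<in> bihom 0 1" "pvar 3 \<in> bihom 0 1"
  unfolding pvar_def by (rule bihom_single; simp add: bideg_def lookup_single)+

section \<open>Linear forms and invertible 2 by 2 matrices\<close>

lemma linear_form_cases:
  assumes "f \<in> bihom a b"
    and "\<And>e. bideg e = (a, b) \<Longrightarrow> e \<in> (\<lambda>i. Poly_Mapping.single i 1) ` {i, j}" and "i \<noteq> j"
  obtains x y where "f = bscale x (pvar i) + bscale y (pvar j)"
proof -
  let ?d = "Poly_Mapping.single i (1::nat)" and ?e = "Poly_Mapping.single j (1::nat)"
  have "Poly_Mapping.keys f \<subseteq> {?d, ?e}"
    using assms(1,2) by (auto simp: bihom_eq)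
  moreover have "?d \<noteq> ?e" using assms(3) by (metis lookup_single_eq lookup_single_not_eq zero_neq_one)
  ultimately have "f = Poly_Mapping.single ?d (Poly_Mapping.lookup f ?d) + Poly_Mapping.single ?e (Poly_Mapping.lookup f ?e)"
    using poly_mapping_eq_sum_single[of "{?d, ?e}" f] by simp
  then show ?thesis
    using that unfolding pvar_def
    by (metis single_eq_bscale)
qed

lemma bihom_1_0_cases:
  assumes "f \<in> bihom 1 0"
  obtains x y where "f = bscale x (pvar 0) + bscale y (pvar 1)"
proof (rule linear_form_cases[OF assms])
  fix e :: "4 \<Rightarrow>\<^sub>0 nat" assume e: "bideg e = (1, 0)"
  show "e \<in> (\<lambda>i. Poly_Mapping.single i 1) ` {0, 1}"
  proof (cases "Poly_Mapping.lookup e 0 = 0")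
    case True
    then have "e = Poly_Mapping.single 1 1"
      using e by (intro exps_eqI) (auto simp: bideg_def lookup_single)
    then show ?thesis by simp
  next
    case False
    then have "e = Poly_Mapping.single 0 1"
      using e by (intro exps_eqI) (auto simp: bideg_def lookup_single)
    then show ?thesis by simp
  qed
qed auto

lemma bihom_0_1_cases:
  assumes "f \<in> bihom 0 1"
  obtains x y where "f = bscale x (pvar 2) + bscale y (pvar 3)"
proof (rule linear_form_cases[OF assms])
  fix e :: "4 \<Rightarrow>\<^sub>0 nat" assume e: "bideg e = (0, 1)"
  show "e \<in> (\<lambda>i. Poly_Mapping.single i 1) ` {2, 3}"
  proof (cases "Poly_Mapping.lookup e 2 = 0")
    case True
    then have "e = Poly_Mapping.single 3 1"
      using e by (intro exps_eqI) (auto simp: bideg_def lookup_single)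
    then show ?thesis by simp
  next
    case False
    then have "e = Poly_Mapping.single 2 1"
      using e by (intro exps_eqI) (auto simp: bideg_def lookup_single)
    then show ?thesis by simp
  qed
qed auto

text \<open>With determinant zero, one row of coefficients is a multiple of the other: the second of
  the first if the first is nonzero, and otherwise the first is 0 times the second.\<close>

lemma nonproportional_det:
  assumes "nonproportional (bscale a F + bscale b G) (bscale c F + bscale d G)"
  shows "a * d - b * c \<noteq> 0"
proof
  assume det: "a * d - b * c = 0"
  have np: "bscale a F + bscale b G \<noteq> bscale z (bscale c F + bscale d G)"
    "bscale c F + bscale d G \<noteq> bscale z (bscale a F + bscale b G)" for z
    using assms unfolding nonproportional_def bscale_def by blast+
  consider "a \<noteq> 0" | "a = 0" "b \<noteq> 0" | "a = 0" "b = 0" by blast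
  then show False
  proof cases
    case 1
    then have "d = c / a * b" "c = c / a * a" using det by (simp_all add: field_simps)
    then show False using np(2)[of "c / a"]
      by (metis bvs.scale_right_distrib bvs.scale_scale)
  next
    case 2
    then have "d = d / b * b" "c = d / b * a" using det by (simp_all add: field_simps)
    then show False using np(2)[of "d / b"]
      by (metis bvs.scale_right_distrib bvs.scale_scale)
  next
    case 3
    then show False using np(1)[of 0] by simp
  qed
qed

text \<open>The adjugate divided by the determinant. Both products are recorded because both
  composites of the two substitutions have to be the identity.\<close>

lemma matrix_inverse_2:
  fixes a b c d :: "'k::field"
  assumes "a * d - b * c \<noteq> 0"
  obtains a' b' c' d' where
    "a' * a + b' * c = 1" "a' * b + b' * d = 0" "c' * a + d' * c = 0" "c' * b + d' * d = 1"
    "a * a' + b * c' = 1" "a * b' + b * d' = 0" "c * a' + d * c' = 0" "c * b' + d * d' = 1"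
proof
  let ?D = "a * d - b * c"
  let ?a = "d / ?D" and ?b = "- b / ?D" and ?c = "- c / ?D" and ?d = "a / ?D"
  show "?a * a + ?b * c = 1" "?a * b + ?b * d = 0" "?c * a + ?d * c = 0" "?c * b + ?d * d = 1"
    "a * ?a + b * ?c = 1" "a * ?b + b * ?d = 0" "c * ?a + d * ?c = 0" "c * ?b + d * ?d = 1"
    using assms by (simp_all add: divide_simps)
qed

lemma bscale_comb:
  "bscale a (bscale b F + bscale c G) + bscale a' (bscale b' F + bscale c' G)
    = bscale (a * b + a' * b') F + bscale (a * c + a' * c') G"
  by (simp add: bscale_def bconst_simps algebra_simps)

lemma graded_automorphism_exists:
  fixes H1 H2 V1 V2 :: "'k::field bipoly"
  assumes "H1 \<in> bihom 1 0" "H2 \<in> bihom 1 0" "nonproportional H1 H2"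
    and "V1 \<in> bihom 0 1" "V2 \<in> bihom 0 1" "nonproportional V1 V2"
  obtains \<phi> \<psi> where "graded_automorphism \<phi> \<psi>"
    "\<phi> (pvar 0) = H1" "\<phi> (pvar 1) = H2" "\<phi> (pvar 2) = V1" "\<phi> (pvar 3) = V2"
proof -
  obtain a b where H1: "H1 = bscale a (pvar 0) + bscale b (pvar 1)" using assms(1) by (rule bihom_1_0_cases)
  obtain c d where H2: "H2 = bscale c (pvar 0) + bscale d (pvar 1)" using assms(2) by (rule bihom_1_0_cases)
  obtain p q where V1: "V1 = bscale p (pvar 2) + bscale q (pvar 3)" using assms(4) by (rule bihom_0_1_cases)
  obtain r s where V2: "V2 = bscale r (pvar 2) + bscale s (pvar 3)" using assms(5) by (rule bihom_0_1_cases)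
  obtain a' b' c' d' where H: "a' * a + b' * c = 1" "a' * b + b' * d = 0" "c' * a + d' * c = 0" "c' * b + d' * d = 1"
    "a * a' + b * c' = 1" "a * b' + b * d' = 0" "c * a' + d * c' = 0" "c * b' + d * d' = 1"
    using assms(3) unfolding H1 H2 by (rule matrix_inverse_2[OF nonproportional_det])
  obtain p' q' r' s' where V: "p' * p + q' * r = 1" "p' * q + q' * s = 0" "r' * p + s' * r = 0" "r' * q + s' * s = 1"
    "p * p' + q * r' = 1" "p * q' + q * s' = 0" "r * p' + s * r' = 0" "r * q' + s * s' = 1"
    using assms(6) unfolding V1 V2 by (rule matrix_inverse_2[OF nonproportional_det])
  define v where "v i = (if i = 0 then H1 else if i = 1 then H2 else if i = 2 then V1 else V2)" for i :: 4
  define w where "w i = (if i = 0 then bscale a' (pvar 0) + bscale b' (pvar 1)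
    else if i = 1 then bscale c' (pvar 0) + bscale d' (pvar 1)
    else if i = 2 then bscale p' (pvar 2) + bscale q' (pvar 3)
    else bscale r' (pvar 2) + bscale s' (pvar 3))" for i :: 4
  have v: "v 0 = H1" "v 1 = H2" "v 2 = V1" "v 3 = V2" by (simp_all add: v_def)
  have w: "w 0 = bscale a' (pvar 0) + bscale b' (pvar 1)" "w 1 = bscale c' (pvar 0) + bscale d' (pvar 1)"
    "w 2 = bscale p' (pvar 2) + bscale q' (pvar 3)" "w 3 = bscale r' (pvar 2) + bscale s' (pvar 3)"
    by (simp_all add: w_def)
  have wv: "psubst w (v i) = pvar i" for i
    using exhaust_4[of i]
    by (elim disjE) (simp_all add: v H1 H2 V1 V2 psubst_add psubst_bscale psubst_pvar w bscale_comb H V)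
  have vw: "psubst v (w i) = pvar i" for i
    using exhaust_4[of i]
    by (elim disjE) (simp_all add: w psubst_add psubst_bscale psubst_pvar v H1 H2 V1 V2 bscale_comb H V)
  have wb: "w 0 \<in> bihom 1 0" "w 1 \<in> bihom 1 0" "w 2 \<in> bihom 0 1" "w 3 \<in> bihom 0 1"
    unfolding w by (intro bihom_add bihom_bscale pvar_bihom)+
  have "graded_automorphism (psubst v) (psubst w)"
  proof
    show "psubst v f \<in> bihom a b" if "f \<in> bihom a b" for f a b
      using assms that by (intro psubst_bihom) (simp_all add: v)
    show "psubst w f \<in> bihom a b" if "f \<in> bihom a b" for f a b
      using wb that by (rule psubst_bihom)
  qed (simp_all add: psubst_add psubst_mult psubst_bconst psubst_psubst wv vw)
  then show thesis
    by (rule that) (simp_all add: psubst_pvar v)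
qed

section \<open>The ideal of the fat points in adapted coordinates\<close>

definition fat_exps :: "nat \<Rightarrow> nat \<Rightarrow> nat \<Rightarrow> (4 \<Rightarrow>\<^sub>0 nat) set" where
  "fat_exps m n l = {e. m \<le> Poly_Mapping.lookup e 0 + Poly_Mapping.lookup e 2 \<and>
     n \<le> Poly_Mapping.lookup e 0 + Poly_Mapping.lookup e 3 \<and>
     l \<le> Poly_Mapping.lookup e 1 + Poly_Mapping.lookup e 2}"

lemma fat_ideal_pvar:
  "fat_ideal (pvar 0) (pvar 1) (pvar 2) (pvar 3) m n l = (monom_ideal (fat_exps m n l) :: 'k::field bipoly set)"
  unfolding fat_ideal_def point_ideal_def
  by (subst (1 2 3) ideal_power_pvar) (auto simp: monom_ideal_def fat_exps_def)

lemma up_closed_fat_exps: "up_closed (fat_exps m n l)"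
  by (auto simp: up_closed_def fat_exps_def lookup_add)

section \<open>Arithmetic of the staircase\<close>

text \<open>D(Z) over the integers, split by the sign of n + l - m; D_2 and D_3 lie on one
  antidiagonal and are merged. Consecutive lines meet at (2n + l - m, m - n) and (m - l, 2l + n - m)
  in the first case, and at (m - l, l) and (n, m - n) in the second.\<close>

definition staircase :: "int \<Rightarrow> int \<Rightarrow> int \<Rightarrow> int \<Rightarrow> int \<Rightarrow> bool" where
  "staircase m n l a b \<longleftrightarrow>
    (if m \<le> n + l
     then (b < max (m - n) 0 \<and> a + 2 * b = m + l) \<or>
          (max (m - n) 0 \<le> b \<and> b \<le> 2 * l + n - m \<and> a + b = n + l) \<or>
          (2 * l + n - m < b \<and> 2 * a + b = m + n)
     else (b < l \<and> a + 2 * b = m + l) \<or> (l \<le> b \<and> b \<le> m - n \<and> a + b = m) \<or>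
          (m - n < b \<and> 2 * a + b = m + n))"

text \<open>The bound (m - n)_+ - (m - n - l)_+ equals (m - n)_+ if m \<le> n + l and l otherwise; l
  + |n - m + l| equals 2l + n - m or m - n accordingly.\<close>

lemma DZ_iff_staircase:
  assumes "l \<le> n" "l < m"
  shows "(a, b) \<in> DZ m n l \<longleftrightarrow> staircase (int m) (int n) (int l) (int a) (int b)"
proof (cases "m \<le> n + l")
  case True
  with assms show ?thesis
    by (auto simp: DZ_def D1_def D2_def D3_def D4_def staircase_def ppart_def Let_def max_def)
next
  case False
  with assms show ?thesis
    by (auto simp: DZ_def D1_def D2_def D3_def D4_def staircase_def ppart_def Let_def max_def)
qed

definition corner_exps :: "int \<Rightarrow> int \<Rightarrow> int \<Rightarrow> int \<Rightarrow> int \<Rightarrow> (int \<times> int) set" where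
  "corner_exps m n l a b =
    {(p, r). 0 \<le> p \<and> 0 \<le> r \<and> m \<le> p + r \<and> a = p + max (l - r) 0 \<and> b = r + max (n - p) 0}"

text \<open>Comparing p with n and r with l makes (a, b) equal to (p, r), (p, r + n - p), (p + l -
  r, r) or (p + l - r, r + n - p). With p + r \<ge> m this gives a + b \<ge> m, 2a + b \<ge> m + n,
  a + 2b \<ge> m + l and a + b = n + l respectively. These are the lines that make up D(Z), and
  strictly below it no case survives.\<close>

lemma corner_exps_below:
  assumes "0 \<le> l" "l \<le> n" "l < m" "staircase m n l i j" "a \<le> i" "b \<le> j" "(a, b) \<noteq> (i, j)"
  shows "corner_exps m n l a b = {}"
proof -
  have False if "0 \<le> p" "0 \<le> r" "m \<le> p + r" "a = p + max (l - r) 0" "b = r + max (n - p) 0" for p r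
    using assms that by (auto simp: staircase_def max_def split: if_splits)
  then show ?thesis unfolding corner_exps_def by auto
qed

text \<open>On the outer lines, and on all of D(Z) when m > n + l, equality forces p + r = m. On the
  segment a + b = n + l for m \<le> n + l it forces p \<le> n and r \<le> l.\<close>

lemma corner_exps_on:
  assumes "0 \<le> l" "l \<le> n" "l < m" "staircase m n l a b" "(p, r) \<in> corner_exps m n l a b"
  shows "p + r = m \<or> p \<le> n \<and> r \<le> l"
  using assms by (auto simp: staircase_def corner_exps_def max_def split: if_splits)

text \<open>Comparing a with n and b with l decides which of q and s vanish and so fixes the
  candidate (p, r). A suitable point of \<open>staircase\<close> turns \<open>above\<close> into the
  inequalities that make this candidate admissible and exclude all others.\<close>

lemma corner_exps_above:
  assumes l: "0 \<le> l" "l \<le> n" "l < m" and ab: "0 \<le> a" "0 \<le> b"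
    and above: "\<And>i j. 0 \<le> i \<Longrightarrow> 0 \<le> j \<Longrightarrow> staircase m n l i j \<Longrightarrow> \<not> (a \<le> i \<and> b \<le> j)"
  shows "card (corner_exps m n l a b) = 1"
proof -
  consider (1) "n \<le> a" "l \<le> b" | (2) "a < n" "l \<le> b" | (3) "n \<le> a" "b < l" | (4) "a < n" "b < l" by linarith
  then have "\<exists>p r. corner_exps m n l a b = {(p, r)}"
  proof cases
    case 1
    have "m \<le> a + b \<and> n + l < a + b"
    proof (cases "m \<le> n + l")
      case True
      \<comment> \<open>At (n, l) the premise \<open>above\<close> says a > n or b > l.\<close>
      then have "staircase m n l n l" using l by (simp add: staircase_def)
      with above[of n l] l 1 True show ?thesis by linarith
    next
      case False
      \<comment> \<open>If a + b < m, the point of the line a + b = m in row b would dominate (a,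
        b).\<close>
      then have "staircase m n l (m - b) b" if "a + b < m" using l 1 that by (simp add: staircase_def)
      with above[of "m - b" b] l 1 ab False show ?thesis by linarith
    qed
    with 1 l have "corner_exps m n l a b = {(a, b)}"
      unfolding corner_exps_def by (auto simp: max_def split: if_splits)
    then show ?thesis by blast
  next
    case 2
    have "n + l < a + b \<and> n + m \<le> 2 * a + b"
    \<comment> \<open>The witness is the point of the staircase in column a. Lying above it gives
      one of the two inequalities, and the case condition yields the other.\<close>
    proof (cases "m \<le> n + l \<and> m - l \<le> a")
      case True
      then have "staircase m n l a (n + l - a)" using l 2 by (simp add: staircase_def)
      with above[of a "n + l - a"] l 2 ab True show ?thesis by linarith
    next
      case False
      then have "staircase m n l a (n + m - 2 * a)" using l 2 by (auto simp: staircase_def)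
      with above[of a "n + m - 2 * a"] l 2 ab False show ?thesis by linarith
    qed
    then have "corner_exps m n l a b = {(a, a + b - n)}"
      using 2 l ab(1) unfolding corner_exps_def by (auto simp: max_def split: if_splits)
    then show ?thesis by blast
  next
    case 3
    have "n + l < a + b \<and> m + l \<le> a + 2 * b"
    \<comment> \<open>The mirror image, with the staircase point in row b.\<close>
    proof (cases "m \<le> n + l \<and> m - n \<le> b")
      case True
      then have "staircase m n l (n + l - b) b" using l 3 ab(2) by (simp add: staircase_def)
      with above[of "n + l - b" b] l 3 ab True show ?thesis by linarith
    next
      case False
      then have "staircase m n l (m + l - 2 * b) b" using l 3 by (auto simp: staircase_def)
      with above[of "m + l - 2 * b" b] l 3 ab False show ?thesis by linarith
    qed
    then have "corner_exps m n l a b = {(a + b - l, b)}"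
      using 3 l ab(2) unfolding corner_exps_def by (auto simp: max_def split: if_splits)
    then show ?thesis by blast
  next
    case 4
    \<comment> \<open>Either (n, l) or, for m > n + l, the point (m - l, l) dominates every such (a,
      b).\<close>
    have False
    proof (cases "m \<le> n + l")
      case True
      then have "staircase m n l n l" using l by (simp add: staircase_def)
      with above[of n l] l 4 show ?thesis by linarith
    next
      case False
      then have "staircase m n l (m - l) l" using l by (simp add: staircase_def)
      with above[of "m - l" l] l 4 False show ?thesis by linarith
    qed
    then show ?thesis ..
  qed
  then show ?thesis by auto
qed

section \<open>Counting exponents of fat points\<close>

text \<open>In a fixed bidegree p and r determine the exponent. Integer coordinates prepare for the
  shifts to a - 1 and b - 1 at 0; the natural subtractions are exact since p \<le> a and r \<le>
  b.\<close>

lemma card_bideg: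
  "card {e. bideg e = (a, b) \<and> e \<in> S} =
    card {(p, r). 0 \<le> p \<and> p \<le> int a \<and> 0 \<le> r \<and> r \<le> int b \<and>
      exps (nat p) (a - nat p) (nat r) (b - nat r) \<in> S}" (is "card ?E = card ?P")
proof (rule bij_betw_same_card[of "\<lambda>e. (int (Poly_Mapping.lookup e 0), int (Poly_Mapping.lookup e 2))"],
    rule bij_betw_byWitness[where f' = "\<lambda>(p, r). exps (nat p) (a - nat p) (nat r) (b - nat r)"])
  have *: "exps (Poly_Mapping.lookup e 0) (a - Poly_Mapping.lookup e 0)
      (Poly_Mapping.lookup e 2) (b - Poly_Mapping.lookup e 2) = e" if "bideg e = (a, b)" for e
    by (rule exps_eqI) (use that in \<open>auto simp: bideg_def\<close>)
  then show "\<forall>e\<in>?E. (\<lambda>(p, r). exps (nat p) (a - nat p) (nat r) (b - nat r))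
      (int (Poly_Mapping.lookup e 0), int (Poly_Mapping.lookup e 2)) = e" by simp
  show "(\<lambda>e. (int (Poly_Mapping.lookup e 0), int (Poly_Mapping.lookup e 2))) ` ?E \<subseteq> ?P"
  proof clarify
    fix e assume e: "bideg e = (a, b)" "e \<in> S"
    with *[OF e(1)] show "0 \<le> int (Poly_Mapping.lookup e 0) \<and> int (Poly_Mapping.lookup e 0) \<le> int a \<and>
      0 \<le> int (Poly_Mapping.lookup e 2) \<and> int (Poly_Mapping.lookup e 2) \<le> int b \<and>
      exps (nat (int (Poly_Mapping.lookup e 0))) (a - nat (int (Poly_Mapping.lookup e 0)))
        (nat (int (Poly_Mapping.lookup e 2))) (b - nat (int (Poly_Mapping.lookup e 2))) \<in> S"
      by (auto simp: bideg_def)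
  qed
qed (auto simp: bideg_def)

text \<open>Since \<open>fat_exps\<close> is up-closed, minimality is tested by lowering a single
  exponent by one: either it is 0, or some condition in which it occurs is an equality.\<close>

lemma exps_mem_min_exps_fat:
  "exps p q r s \<in> min_exps (fat_exps m n l) \<longleftrightarrow>
    m \<le> p + r \<and> n \<le> p + s \<and> l \<le> q + r \<and>
    (p = 0 \<or> p + r = m \<or> p + s = n) \<and> (q = 0 \<or> q + r = l) \<and>
    (r = 0 \<or> p + r = m \<or> q + r = l) \<and> (s = 0 \<or> p + s = n)" (is "?L \<longleftrightarrow> ?R")
proof
  assume L: ?L
  have up: "exps p' q' r' s' \<notin> fat_exps m n l"
    if "p = d0 + p'" "q = d1 + q'" "r = d2 + r'" "s = d3 + s'" "d0 + d1 + d2 + d3 \<noteq> 0" for p' q' r' s' d0 d1 d2 d3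
  proof
    assume "exps p' q' r' s' \<in> fat_exps m n l"
    moreover have "exps d0 d1 d2 d3 + exps p' q' r' s' = exps p q r s"
      by (rule exps_eqI) (simp_all add: lookup_add that)
    ultimately have "exps d0 d1 d2 d3 = 0" by (metis min_expsD(2) L)
    then have "bideg (exps d0 d1 d2 d3) = (0, 0)" by (simp add: bideg_eq_0_iff)
    with that(5) show False by (simp add: bideg_def)
  qed
  have "p \<noteq> 0 \<longrightarrow> exps (p - 1) q r s \<notin> fat_exps m n l" "q \<noteq> 0 \<longrightarrow> exps p (q - 1) r s \<notin> fat_exps m n l"
    "r \<noteq> 0 \<longrightarrow> exps p q (r - 1) s \<notin> fat_exps m n l" "s \<noteq> 0 \<longrightarrow> exps p q r (s - 1) \<notin> fat_exps m n l"
    using up[of 1 "p - 1" 0 q 0 r 0 s] up[of 0 p 1 "q - 1" 0 r 0 s]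
      up[of 0 p 0 q 1 "r - 1" 0 s] up[of 0 p 0 q 0 r 1 "s - 1"] by simp_all
  with min_expsD(1)[OF L] show ?R
    by (simp add: fat_exps_def) linarith
next
  assume R: ?R
  have "d = 0" if "e \<in> fat_exps m n l" "exps p q r s = d + e" for d e
  proof (rule exps_eqI)
    have "p = Poly_Mapping.lookup d 0 + Poly_Mapping.lookup e 0" "q = Poly_Mapping.lookup d 1 + Poly_Mapping.lookup e 1"
      "r = Poly_Mapping.lookup d 2 + Poly_Mapping.lookup e 2" "s = Poly_Mapping.lookup d 3 + Poly_Mapping.lookup e 3"
      by (metis that(2) lookup_add lookup_exps(1), metis that(2) lookup_add lookup_exps(2),
        metis that(2) lookup_add lookup_exps(3), metis that(2) lookup_add lookup_exps(4))
    with R that(1) show "Poly_Mapping.lookup d 0 = Poly_Mapping.lookup 0 0" "Poly_Mapping.lookup d 1 = Poly_Mapping.lookup 0 1"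
      "Poly_Mapping.lookup d 2 = Poly_Mapping.lookup 0 2" "Poly_Mapping.lookup d 3 = Poly_Mapping.lookup 0 3"
      by (auto simp: fat_exps_def)
  qed
  with R show ?L unfolding min_exps_def by (auto simp: fat_exps_def)
qed

definition fat_pairs :: "int \<Rightarrow> int \<Rightarrow> int \<Rightarrow> int \<Rightarrow> int \<Rightarrow> (int \<times> int) set" where
  "fat_pairs m n l a b = {(p, r). 0 \<le> p \<and> p \<le> a \<and> 0 \<le> r \<and> r \<le> b \<and>
    m \<le> p + r \<and> n \<le> p + (b - r) \<and> l \<le> (a - p) + r}"

lemma fat_pairs_subset: "fat_pairs m n l a b \<subseteq> {0..a} \<times> {0..b}"
  by (auto simp: fat_pairs_def)

lemma finite_fat_pairs: "finite (fat_pairs m n l a b)"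
  using fat_pairs_subset by (rule finite_subset) simp

text \<open>For fixed (p, r), a enters only through q and b only through s. Hence the pairs that
  survive both decrements are those of (a - 1, b - 1), and those that survive neither have q and s
  at their least values.\<close>

lemma card_fat_pairs_diff:
  assumes "0 \<le> l" "0 \<le> n" "0 \<le> a" "0 \<le> b"
  shows "int (card (fat_pairs m n l a b)) + int (card (fat_pairs m n l (a - 1) (b - 1)))
    - int (card (fat_pairs m n l (a - 1) b)) - int (card (fat_pairs m n l a (b - 1)))
    = int (card (corner_exps m n l a b))"
proof -
  let ?A = "fat_pairs m n l"
  have "?A (a - 1) b \<inter> ?A a (b - 1) = ?A (a - 1) (b - 1)"
    by (auto simp: fat_pairs_def)
  then have U: "card (?A (a - 1) b \<union> ?A a (b - 1)) + card (?A (a - 1) (b - 1)) = card (?A (a - 1) b) + card (?A a (b - 1))"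
    using card_Un_Int[OF finite_fat_pairs finite_fat_pairs, of m n l "a - 1" b m n l a "b - 1"] by simp
  have eq: "?A a b = (?A (a - 1) b \<union> ?A a (b - 1)) \<union> corner_exps m n l a b"
    using assms by (auto simp: fat_pairs_def corner_exps_def max_def)
  then have "finite (corner_exps m n l a b)"
    using finite_fat_pairs[of m n l a b] by simp
  moreover have "(?A (a - 1) b \<union> ?A a (b - 1)) \<inter> corner_exps m n l a b = {}"
    using assms by (auto simp: fat_pairs_def corner_exps_def max_def)
  ultimately have "card (?A a b) = card (?A (a - 1) b \<union> ?A a (b - 1)) + card (corner_exps m n l a b)"
    unfolding eq by (intro card_Un_disjoint) (simp_all add: finite_fat_pairs)
  with U show ?thesis by linarith
qed

text \<open>There are (i + 1)(j + 1) monomials of bidegree (i, j). At i = -1 or j = -1 both sides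
  vanish, so the formula serves all four terms of the difference. The assumption
  \<open>0 < m\<close> keeps 1 out of the ideal.\<close>

lemma (in graded_automorphism) hilbert_fat:
  assumes "0 < m" "- 1 \<le> i" "- 1 \<le> j"
  shows "hilbert (\<phi> ` monom_ideal (fat_exps m n l)) i j =
    (i + 1) * (j + 1) - int (card (fat_pairs (int m) (int n) (int l) i j))"
proof (cases "0 \<le> i \<and> 0 \<le> j")
  case False
  with assms have "i = - 1 \<or> j = - 1" by auto
  moreover from this have "fat_pairs (int m) (int n) (int l) i j = {}" by (auto simp: fat_pairs_def)
  ultimately show ?thesis by (auto simp: hilbert_def)
next
  case True
  then obtain a b where ij: "i = int a" "j = int b" by (metis nonneg_int_cases)
  let ?A = "fat_pairs (int m) (int n) (int l) (int a) (int b)"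
  have "hilbert (\<phi> ` monom_ideal (fat_exps m n l)) i j = int (card {e. bideg e = (a, b) \<and> e \<in> - fat_exps m n l})"
    unfolding ij using assms(1) hilbert_image_monom_ideal[OF up_closed_fat_exps, of m n l a b]
    by (simp add: fat_exps_def)
  also have "{(p, r). 0 \<le> p \<and> p \<le> int a \<and> 0 \<le> r \<and> r \<le> int b \<and>
      exps (nat p) (a - nat p) (nat r) (b - nat r) \<in> - fat_exps m n l} = ({0..int a} \<times> {0..int b}) - ?A"
    by (auto simp: fat_exps_def fat_pairs_def)
  then have "card {e. bideg e = (a, b) \<and> e \<in> - fat_exps m n l} = card (({0..int a} \<times> {0..int b}) - ?A)"
    unfolding card_bideg by simp
  also have "\<dots> = card ({0..int a} \<times> {0..int b}) - card ?A"
    by (rule card_Diff_subset[OF finite_fat_pairs fat_pairs_subset])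
  also have "int \<dots> = (i + 1) * (j + 1) - int (card ?A)"
    using card_mono[OF _ fat_pairs_subset, of "int a" "int b" "int m" "int n" "int l"]
    by (simp add: ij of_nat_diff card_cartesian_product)
  finally show ?thesis by (simp add: ij)
qed

text \<open>The constant 1 is the mixed difference of (i + 1)(j + 1).\<close>

lemma (in graded_automorphism) delta_hilbert_fat:
  assumes "0 < m"
  shows "delta_hilbert (\<phi> ` monom_ideal (fat_exps m n l)) (int a) (int b) =
    1 - int (card (corner_exps (int m) (int n) (int l) (int a) (int b)))"
  using card_fat_pairs_diff[of "int l" "int n" "int a" "int b" "int m"]
  by (simp add: delta_hilbert_def hilbert_fat[OF assms] algebra_simps)

text \<open>Truncated subtraction of naturals is the positive part of the integer
  difference.\<close>

lemma corner_exps_of_nat: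
  "(int p, int r) \<in> corner_exps (int m) (int n) (int l) (int (p + q)) (int (r + s)) \<longleftrightarrow>
    m \<le> p + r \<and> q = l - r \<and> s = n - p"
proof -
  have "max (int l - int r) 0 = int (l - r)" "max (int n - int p) 0 = int (n - p)" by auto
  then show ?thesis by (auto simp: corner_exps_def)
qed

text \<open>At a corner p + s = max p n and q + r = max r l. So p cannot be lowered exactly if p + r
  = m or p \<le> n, and r exactly if p + r = m or r \<le> l.\<close>

lemma min_exps_fat_iff_corner:
  "exps p q r s \<in> min_exps (fat_exps m n l) \<longleftrightarrow>
    (int p, int r) \<in> corner_exps (int m) (int n) (int l) (int (p + q)) (int (r + s)) \<and>
    (p + r = m \<or> p \<le> n \<and> r \<le> l)"
proof -
  have "m \<le> p + r \<and> q = l - r \<and> s = n - p \<longleftrightarrow>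
    m \<le> p + r \<and> n \<le> p + s \<and> l \<le> q + r \<and> (q = 0 \<or> q + r = l) \<and> (s = 0 \<or> p + s = n)"
    by auto
  then show ?thesis
    unfolding corner_exps_of_nat exps_mem_min_exps_fat by auto
qed

lemma (in graded_automorphism) betti0_fat:
  "betti0 (\<phi> ` monom_ideal (fat_exps m n l)) a b =
    card {(p, r) \<in> corner_exps (int m) (int n) (int l) (int a) (int b).
      p + r = int m \<or> p \<le> int n \<and> r \<le> int l}"
proof -
  have "betti0 (\<phi> ` monom_ideal (fat_exps m n l)) a b = card {e. bideg e = (a, b) \<and> e \<in> min_exps (fat_exps m n l)}"
    unfolding betti0_image betti0_monom_ideal[OF up_closed_fat_exps] by (rule arg_cong[of _ _ card]) auto
  also have "\<dots> = card {(p, r) \<in> corner_exps (int m) (int n) (int l) (int a) (int b).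
      p + r = int m \<or> p \<le> int n \<and> r \<le> int l}"
    unfolding card_bideg
  proof (rule arg_cong[of _ _ card], rule Collect_cong, clarify, rule iffI)
    fix p r :: int
    assume *: "0 \<le> p \<and> p \<le> int a \<and> 0 \<le> r \<and> r \<le> int b \<and>
      exps (nat p) (a - nat p) (nat r) (b - nat r) \<in> min_exps (fat_exps m n l)"
    then obtain p' r' where pr: "p = int p'" "r = int r'" by (metis nonneg_int_cases)
    with * have "a = p' + (a - p')" "b = r' + (b - r')" by simp_all
    with * min_exps_fat_iff_corner[of p' "a - p'" r' "b - r'"]
    have "(p, r) \<in> corner_exps (int m) (int n) (int l) (int a) (int b)" "p' + r' = m \<or> p' \<le> n \<and> r' \<le> l"
      by (simp_all add: pr)
    then show "(p, r) \<in> corner_exps (int m) (int n) (int l) (int a) (int b) \<and>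
        (p + r = int m \<or> p \<le> int n \<and> r \<le> int l)"
      by (auto simp: pr)
  next
    fix p r :: int
    assume *: "(p, r) \<in> corner_exps (int m) (int n) (int l) (int a) (int b) \<and>
        (p + r = int m \<or> p \<le> int n \<and> r \<le> int l)"
    then have le: "0 \<le> p" "p \<le> int a" "0 \<le> r" "r \<le> int b" by (auto simp: corner_exps_def)
    then obtain p' r' where pr: "p = int p'" "r = int r'" by (metis nonneg_int_cases)
    with le have "a = p' + (a - p')" "b = r' + (b - r')" by simp_all
    with * have "exps p' (a - p') r' (b - r') \<in> min_exps (fat_exps m n l)"
      unfolding min_exps_fat_iff_corner pr by auto
    with le show "0 \<le> p \<and> p \<le> int a \<and> 0 \<le> r \<and> r \<le> int b \<and>
      exps (nat p) (a - nat p) (nat r) (b - nat r) \<in> min_exps (fat_exps m n l)"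
      by (simp add: pr)
  qed
  finally show ?thesis .
qed

theorem proposition5p4:
  fixes H1 H2 V1 V2 :: "('k::field_char_0) bipoly"
    and m11 m12 m21 :: nat
  assumes "H1 \<in> bihom 1 0" "H1 \<noteq> 0" "H2 \<in> bihom 1 0" "H2 \<noteq> 0" "nonproportional H1 H2"
    and "V1 \<in> bihom 0 1" "V1 \<noteq> 0" "V2 \<in> bihom 0 1" "V2 \<noteq> 0" "nonproportional V1 V2"
    and "m12 \<ge> m21"
    and "m11 > m21"
  shows "\<forall>a b :: nat.
    ((\<exists>d \<in> DZ m11 m12 m21. bideg_less (a, b) d) \<longrightarrow>
       delta_hilbert (fat_ideal H1 H2 V1 V2 m11 m12 m21) (int a) (int b) = 1) \<and>
    ((a, b) \<in> DZ m11 m12 m21 \<longrightarrow>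
       delta_hilbert (fat_ideal H1 H2 V1 V2 m11 m12 m21) (int a) (int b) =
         1 - int (betti0 (fat_ideal H1 H2 V1 V2 m11 m12 m21) a b)) \<and>
    ((a, b) \<notin> DZ m11 m12 m21 \<and> \<not> (\<exists>d \<in> DZ m11 m12 m21. bideg_less (a, b) d) \<longrightarrow>
       delta_hilbert (fat_ideal H1 H2 V1 V2 m11 m12 m21) (int a) (int b) = 0)"
proof -
  obtain \<phi> \<psi> where "graded_automorphism \<phi> \<psi>"
    and v: "\<phi> (pvar 0) = H1" "\<phi> (pvar 1) = H2" "\<phi> (pvar 2) = V1" "\<phi> (pvar 3) = V2"
    using graded_automorphism_exists assms by metis
  then interpret graded_automorphism \<phi> \<psi> by blast
  let ?m = "int m11" and ?n = "int m12" and ?l = "int m21"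
  have I: "fat_ideal H1 H2 V1 V2 m11 m12 m21 = \<phi> ` monom_ideal (fat_exps m11 m12 m21)"
    using fat_ideal_image[of "pvar 0" "pvar 1" "pvar 2" "pvar 3"] by (simp add: v fat_ideal_pvar)
  have delta: "delta_hilbert (fat_ideal H1 H2 V1 V2 m11 m12 m21) (int a) (int b) =
      1 - int (card (corner_exps ?m ?n ?l (int a) (int b)))" for a b
    \<comment> \<open>\<open>m11 > m21\<close> gives \<open>m11 > 0\<close>, so the ideal is
      proper.\<close>
    unfolding I using assms(12) by (intro delta_hilbert_fat) simp
  have DZ: "(i, j) \<in> DZ m11 m12 m21 \<longleftrightarrow> staircase ?m ?n ?l (int i) (int j)" for i j
    using assms by (intro DZ_iff_staircase)
  show ?thesis
  proof (intro allI conjI impI)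
    fix a b
    assume "\<exists>d\<in>DZ m11 m12 m21. bideg_less (a, b) d"
    then obtain d where "d \<in> DZ m11 m12 m21" "bideg_less (a, b) d" by blast
    then obtain i j where "(i, j) \<in> DZ m11 m12 m21" "a \<le> i" "b \<le> j" "(a, b) \<noteq> (i, j)"
      by (cases d) (simp add: bideg_less_def)
    then have "corner_exps ?m ?n ?l (int a) (int b) = {}"
      using assms(11,12) by (intro corner_exps_below[of _ _ _ "int i" "int j"]) (auto simp: DZ)
    then show "delta_hilbert (fat_ideal H1 H2 V1 V2 m11 m12 m21) (int a) (int b) = 1"
      by (simp add: delta)
  next
    fix a b
    assume "(a, b) \<in> DZ m11 m12 m21"
    then have "{(p, r) \<in> corner_exps ?m ?n ?l (int a) (int b). p + r = ?m \<or> p \<le> ?n \<and> r \<le> ?l}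
        = corner_exps ?m ?n ?l (int a) (int b)"
      using corner_exps_on[of ?l ?n ?m "int a" "int b"] assms(11,12) by (auto simp: DZ)
    then show "delta_hilbert (fat_ideal H1 H2 V1 V2 m11 m12 m21) (int a) (int b) =
         1 - int (betti0 (fat_ideal H1 H2 V1 V2 m11 m12 m21) a b)"
      unfolding delta by (simp add: I betti0_fat)
  next
    fix a b
    assume ab: "(a, b) \<notin> DZ m11 m12 m21 \<and> \<not> (\<exists>d\<in>DZ m11 m12 m21. bideg_less (a, b) d)"
    \<comment> \<open>A nonnegative integer point of the staircase comes from D(Z); to be weakly
      dominated by it means to equal it or to lie strictly below it, and both are excluded.\<close>
    have "\<not> (int a \<le> i \<and> int b \<le> j)" if ij: "0 \<le> i" "0 \<le> j" "staircase ?m ?n ?l i j" for i j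
    proof
      assume le: "int a \<le> i \<and> int b \<le> j"
      obtain c d where cd: "i = int c" "j = int d" using ij(1,2) by (metis nonneg_int_cases)
      then have "(c, d) \<in> DZ m11 m12 m21" using ij(3) by (simp add: DZ)
      moreover from this have "bideg_less (a, b) (c, d)" using ab le cd by (auto simp: bideg_less_def)
      ultimately show False using ab by blast
    qed
    then have "card (corner_exps ?m ?n ?l (int a) (int b)) = 1"
      using assms(11,12) by (intro corner_exps_above) auto
    then show "delta_hilbert (fat_ideal H1 H2 V1 V2 m11 m12 m21) (int a) (int b) = 0"
      by (simp add: delta)
  qed
qed

end
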